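(* Let $\mu=(p,q,r,s)\in\mathbb{C}^4$. Then: (1) there exists a constant $l=l(\mu)>0$ such that for every $\mu$-Markoff map $\phi\in\Phi_\mu$ the set $\Omega_\phi(l)$ is non-empty; (2) there exists a constant $\alpha=\alpha(\mu)\ge 0$ such that for every $\phi\in\Phi_\mu$ and every $k\ge 2+\alpha$, the set $\Omega_\phi(k)$ is connected, i.e. the union of the regions belonging to $\Omega_\phi(k)$ is a connected subset of the plane.
   Context: Let $\Sigma$ be a countably infinite simplicial tree, properly embedded in the plane, all of whose vertices have degree $3$. A complementary region is the closure of a connected component of the complement of $\Sigma$ in the plane; $\Omega$ denotes the set of complementary regions and $E(\Sigma)$ the set of edges. Every edge $e$ is the intersection of exactly two regions $X,Y$, and its two endpoints lie on two further regions $Z,W$ respectively; we write $e\leftrightarrow(X,Y;Z,W)$. Exactly three regions meet at each vertex. Fix a coloring $\mathcal C:\Omega\cup E(\Sigma)\to\{1,2,3\}$ such that for every $e\leftrightarrow(X,Y;Z,W)$ we have $\mathcal C(e)=\mathcal C(Z)=\mathcal C(W)$ and $\mathcal C(e),\mathcal C(X),\mathcal C(Y)$ pairwise distinct; let $\Omega_i$, $E_i$ be the regions/edges of color $i$. For $\mu=(p,q,r,s)\in\mathbb{C}^4$, a $\mu$-Markoff map is a function $\phi:\Omega\to\mathbb{C}$ such that (i) at every vertex, if $X\in\Omega_1,Y\in\Omega_2,Z\in\Omega_3$ are the three regions meeting there and $x=\phi(X),y=\phi(Y),z=\phi(Z)$, then $x^2+y^2+z^2+xyz=px+qy+rz+s$;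 (ii) for $e\in E_1$ with $e\leftrightarrow(Y,Z;X,X')$: $\phi(X)+\phi(X')=p-\phi(Y)\phi(Z)$; for $e\in E_2$ with $e\leftrightarrow(X,Z;Y,Y')$: $\phi(Y)+\phi(Y')=q-\phi(X)\phi(Z)$; for $e\in E_3$ with $e\leftrightarrow(X,Y;Z,Z')$: $\phi(Z)+\phi(Z')=r-\phi(X)\phi(Y)$. $\Phi_\mu$ denotes the set of $\mu$-Markoff maps. For $k\ge0$, $\Omega_\phi(k)=\{X\in\Omega: |\phi(X)|\le k\}$. *)

theory Defs
  imports "HOL-Analysis.Analysis"
begin

text \<open>A planar embedded graph is given by a vertex set V (points of the plane, modelled
as complex numbers) and a set E of edges, each edge being an arc (as a point set) whose
intersection with V is exactly its two endpoints.\<close>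

definition is_edge_arc :: "complex set \<Rightarrow> complex set \<Rightarrow> bool" where
  "is_edge_arc V e \<longleftrightarrow> (\<exists>\<gamma>. arc \<gamma> \<and> path_image \<gamma> = e \<and>
       e \<inter> V = {pathstart \<gamma>, pathfinish \<gamma>})"

definition adjacent_vertices :: "complex set set \<Rightarrow> complex \<Rightarrow> complex \<Rightarrow> bool" where
  "adjacent_vertices E u v \<longleftrightarrow> u \<noteq> v \<and> (\<exists>e\<in>E. u \<in> e \<and> v \<in> e)"

definition has_cycle :: "complex set \<Rightarrow> complex set set \<Rightarrow> bool" where
  "has_cycle V E \<longleftrightarrow> (\<exists>vs. length vs \<ge> 3 \<and> distinct vs \<and> set vs \<subseteq> V \<and>
       (\<forall>i. Suc i < length vs \<longrightarrow> adjacent_vertices E (vs ! i) (vs ! Suc i)) \<and>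
       adjacent_vertices E (last vs) (hd vs))"

definition graph_connected :: "complex set \<Rightarrow> complex set set \<Rightarrow> bool" where
  "graph_connected V E \<longleftrightarrow> (\<forall>u\<in>V. \<forall>v\<in>V. (adjacent_vertices E)\<^sup>*\<^sup>* u v)"

definition trivalent_planar_tree :: "complex set \<Rightarrow> complex set set \<Rightarrow> bool" where
  "trivalent_planar_tree V E \<longleftrightarrow>
     countable V \<and> infinite V \<and>
     (\<forall>e\<in>E. is_edge_arc V e) \<and>
     (\<forall>e\<in>E. \<forall>e'\<in>E. e \<noteq> e' \<longrightarrow> e \<inter> e' \<subseteq> V) \<and>
     (\<forall>e\<in>E. \<forall>e'\<in>E. e \<inter> V = e' \<inter> V \<longrightarrow> e = e') \<and>
     (\<forall>v\<in>V. card {e\<in>E. v \<in> e} = 3) \<and>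
     graph_connected V E \<and> \<not> has_cycle V E \<and>
     (\<forall>K. compact K \<longrightarrow> finite {e\<in>E. e \<inter> K \<noteq> {}})"

definition regions :: "complex set set \<Rightarrow> complex set set" where
  "regions E = closure ` components (UNIV - \<Union>E)"

definition edge_rel :: "complex set \<Rightarrow> complex set set \<Rightarrow> complex set \<Rightarrow>
    complex set \<Rightarrow> complex set \<Rightarrow> complex set \<Rightarrow> complex set \<Rightarrow> bool" where
  "edge_rel V E e X Y Z W \<longleftrightarrow> e \<in> E \<and>
     X \<in> regions E \<and> Y \<in> regions E \<and> Z \<in> regions E \<and> W \<in> regions E \<and>
     X \<noteq> Y \<and> X \<inter> Y = e \<and> Z \<notin> {X, Y} \<and> W \<notin> {X, Y} \<and>
     (\<exists>u w. u \<noteq> w \<and> e \<inter> V = {u, w} \<and> u \<in> Z \<and> w \<in> W)"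

definition admissible_coloring :: "complex set \<Rightarrow> complex set set \<Rightarrow>
    (complex set \<Rightarrow> nat) \<Rightarrow> (complex set \<Rightarrow> nat) \<Rightarrow> bool" where
  "admissible_coloring V E colR colE \<longleftrightarrow>
     (\<forall>X\<in>regions E. colR X \<in> {1,2,3}) \<and> (\<forall>e\<in>E. colE e \<in> {1,2,3}) \<and>
     (\<forall>e X Y Z W. edge_rel V E e X Y Z W \<longrightarrow>
        colE e = colR Z \<and> colE e = colR W \<and>
        colE e \<noteq> colR X \<and> colE e \<noteq> colR Y \<and> colR X \<noteq> colR Y)"

definition markoff_map :: "complex set \<Rightarrow> complex set set \<Rightarrow>
    (complex set \<Rightarrow> nat) \<Rightarrow> (complex set \<Rightarrow> nat) \<Rightarrow>
    complex \<Rightarrow> complex \<Rightarrow> complex \<Rightarrow> complex \<Rightarrow> (complex set \<Rightarrow> complex) \<Rightarrow> bool" where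
  "markoff_map V E colR colE p q r s \<phi> \<longleftrightarrow>
     (\<forall>v\<in>V. \<forall>X\<in>regions E. \<forall>Y\<in>regions E. \<forall>Z\<in>regions E.
        v \<in> X \<and> v \<in> Y \<and> v \<in> Z \<and> colR X = 1 \<and> colR Y = 2 \<and> colR Z = 3 \<longrightarrow>
        (\<phi> X)\<^sup>2 + (\<phi> Y)\<^sup>2 + (\<phi> Z)\<^sup>2 + \<phi> X * \<phi> Y * \<phi> Z
          = p * \<phi> X + q * \<phi> Y + r * \<phi> Z + s) \<and>
     (\<forall>e Y Z X X'. edge_rel V E e Y Z X X' \<and> colE e = 1 \<longrightarrow>
        \<phi> X + \<phi> X' = p - \<phi> Y * \<phi> Z) \<and>
     (\<forall>e X Z Y Y'. edge_rel V E e X Z Y Y' \<and> colE e = 2 \<longrightarrow>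
        \<phi> Y + \<phi> Y' = q - \<phi> X * \<phi> Z) \<and>
     (\<forall>e X Y Z Z'. edge_rel V E e X Y Z Z' \<and> colE e = 3 \<longrightarrow>
        \<phi> Z + \<phi> Z' = r - \<phi> X * \<phi> Y)"

definition Omega_phi :: "complex set set \<Rightarrow> (complex set \<Rightarrow> complex) \<Rightarrow> real \<Rightarrow> complex set set" where
  "Omega_phi E \<phi> k = {X \<in> regions E. cmod (\<phi> X) \<le> k}"

end

theory Submission
  imports Defs
begin

text \<open>Adding a point at infinity turns a bi-infinite geodesic of the tree into a Jordan curve.
  Janiszewski's theorem says that near an open edge (or near a vertex) two points are
  separated by the whole tree only if they are separated by a geodesic through the edge (or by
  three rays issuing from the vertex), because everything else is joined up at infinity. Hence an
  edge lies on exactly two regions and a vertex on exactly three.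

  The theorem then follows from Bowditch's descent arguments. With
  \<open>M = |p| + |q| + |r| + |s|\<close>, a vertex at which the product of the three absolute values is
  within a factor 2 of its infimum over all vertices must carry a value at most \<open>29 + M\<close>. For
  \<open>k \<ge> 2 + M\<close>, on a non-backtracking walk between two vertices of the sublevel set which leaves the
  set, \<open>|\<phi>|\<close> increases along the first edge and decreases along the last one, so some vertex in
  between has two descending edges, and this is impossible when all three values exceed
  \<open>2 + M\<close>.\<close>

subsection \<open>Inversion and an unbounded Janiszewski theorem\<close>

text \<open>The definitions supply only point sets, so the incidences that the English statement
  takes for granted have to be proved: exactly two regions contain a given edge, these two meet in
  nothing more than the edge, and exactly three regions meet at a vertex. Separation by one geodesic
  bounds the intersection of the two regions along an edge by that geodesic only; a second geodesic
  that shares nothing but this edge with the first cuts the bound down to the edge. Incidence with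
  an edge is tested on its open part \<open>e - V\<close>, because a further region touches it at
  each end.

  The factor 2 in the descent is there because the products of absolute values may accumulate, so
  that their infimum need not be attained. A vertex near the infimum is an approximate sink:
  crossing the edge opposite its largest value cannot halve that value. Two crude estimates then
  bound the smallest value by 28. In the threshold \<open>29 + M\<close> the summand
  \<open>M\<close> lets every linear term of the vertex equation be absorbed into a square.\<close>

definition inversion :: "complex \<Rightarrow> complex \<Rightarrow> complex" where
  "inversion a z = inverse (z - a)"

lemma inversion_eq_0_iff [simp]: "inversion a z = 0 \<longleftrightarrow> z = a"
  by (simp add: inversion_def)

lemma inversion_inverse: "a + inverse (inversion a z) = z"
  by (simp add: inversion_def)

lemma inversion_of_inverse: "inversion a (a + inverse w) = w"
  by (simp add: inversion_def)

lemma inj_inversion: "inj (inversion a)"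
  by (metis injI inversion_inverse)

lemma continuous_on_inversion: "a \<notin> A \<Longrightarrow> continuous_on A (inversion a)"
  unfolding inversion_def by (intro continuous_intros) auto

text \<open>Points of \<open>A\<close> that go to infinity have images going to 0, so 0 stands for
  the point at infinity as long as the pole \<open>a\<close> is off \<open>A\<close>. The complement
  is open because it is the preimage of \<open>-A\<close> under the inverse map, away from
  0.\<close>

lemma closed_inversion_image:
  assumes "closed A" "a \<notin> A"
  shows "closed (insert 0 (inversion a ` A))"
proof -
  have "- insert 0 (inversion a ` A) = (\<lambda>w. a + inverse w) -` (-A) \<inter> (-{0})"
    using inversion_inverse inversion_of_inverse by (auto simp: image_iff) metis
  moreover have "open ((\<lambda>w. a + inverse w) -` (-A) \<inter> (-{0}))"
    by (subst Int_commute) (use assms in \<open>auto intro!: continuous_open_preimage continuous_intros\<close>)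
  ultimately show ?thesis
    by (simp add: closed_def)
qed

lemma bounded_inversion_image:
  assumes "closed A" "a \<notin> A"
  shows "bounded (inversion a ` A)"
proof -
  obtain d where d: "d > 0" "ball a d \<subseteq> -A"
    using assms by (meson ComplI open_Compl openE)
  have "norm (inversion a z) \<le> inverse d" if "z \<in> A" for z
  proof -
    have "dist a z \<ge> d"
      using d that by (meson ComplD in_mono mem_ball not_le)
    then have "norm (z - a) \<ge> d"
      by (simp add: dist_norm norm_minus_commute)
    then show ?thesis
      using d(1) by (simp add: inversion_def norm_inverse le_imp_inverse_le)
  qed
  then show ?thesis
    by (auto simp: bounded_iff)
qed

lemma compact_inversion_image:
  assumes "closed A" "a \<notin> A"
  shows "compact (insert 0 (inversion a ` A))"
  using closed_inversion_image[OF assms] bounded_inversion_image[OF assms]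
  by (simp add: compact_eq_bounded_closed)

text \<open>A set connecting \<open>x\<close> to \<open>y\<close> may run through the pole. It is
  therefore enlarged to a whole component of \<open>-A\<close>, which is open, and an open connected
  set in the plane stays connected when a point is removed.\<close>

lemma connected_component_inversion:
  assumes "closed A" "connected_component (-A) x y" "x \<noteq> a" "y \<noteq> a"
  shows "connected_component (- insert 0 (inversion a ` A)) (inversion a x) (inversion a y)"
proof -
  define C where "C = connected_component_set (-A) x"
  have "open C" "connected C" "C \<subseteq> -A" "x \<in> C" "y \<in> C"
    unfolding C_def using assms connected_component_in[OF assms(2)] connected_component_subset[of "-A" x]
    by (auto intro: open_connected_component)
  then have "connected (C - {a})"
    by (intro connected_open_delete) auto
  then have "connected (inversion a ` (C - {a}))"
    by (intro connected_continuous_image continuous_on_inversion) auto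
  moreover have "inversion a ` (C - {a}) \<subseteq> - insert 0 (inversion a ` A)"
    using \<open>C \<subseteq> -A\<close> inj_inversion[of a] by (auto dest: injD)
  ultimately show ?thesis
    unfolding connected_component_def using \<open>x \<in> C\<close> \<open>y \<in> C\<close> assms(3,4) by blast
qed

lemma connected_component_inversion_back:
  assumes "connected_component (- insert 0 (inversion a ` A)) (inversion a x) (inversion a y)"
  shows "connected_component (-A) x y"
proof -
  obtain T where T: "connected T" "T \<subseteq> - insert 0 (inversion a ` A)"
    "inversion a x \<in> T" "inversion a y \<in> T"
    using assms unfolding connected_component_def by blast
  have "connected ((\<lambda>w. a + inverse w) ` T)"
    using T by (intro connected_continuous_image continuous_intros) auto
  moreover have "(\<lambda>w. a + inverse w) ` T \<subseteq> -A"
    using T(2) by (auto simp: image_iff) (metis inversion_of_inverse subset_Compl_self_eq ComplD image_eqI insertCI subsetD)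
  moreover have "x \<in> (\<lambda>w. a + inverse w) ` T" "y \<in> (\<lambda>w. a + inverse w) ` T"
    using T(3,4) inversion_inverse by (metis image_eqI)+
  ultimately show ?thesis
    unfolding connected_component_def by blast
qed

text \<open>Unboundedness makes 0 a limit point of the image. Any number of disjoint unbounded
  connected sets are thus tied together at 0, which is how the connected intersection required by
  Janiszewski's theorem arises.\<close>

lemma connected_insert_0_inversion:
  assumes "connected C" "\<not> bounded C" "a \<notin> C"
  shows "connected (insert 0 (inversion a ` C))"
proof (rule connected_intermediate_closure)
  show "connected (inversion a ` C)"
    using assms by (intro connected_continuous_image continuous_on_inversion)
  have "0 \<in> closure (inversion a ` C)"
    unfolding closure_approachable
  proof (intro allI impI)
    fix e :: real assume "e > 0"
    obtain z where z: "z \<in> C" "norm z > norm a + inverse e"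
      using assms(2) by (meson bounded_iff not_le)
    have "norm (z - a) > inverse e"
      using z(2) norm_triangle_ineq2[of z a] by linarith
    then have "norm (inversion a z) < e"
      unfolding inversion_def norm_inverse
      using \<open>e > 0\<close> by (metis inverse_inverse_eq less_imp_inverse_less positive_imp_inverse_positive)
    then show "\<exists>y\<in>inversion a ` C. dist y 0 < e"
      using z(1) by auto
  qed
  then show "insert 0 (inversion a ` C) \<subseteq> closure (inversion a ` C)"
    using closure_subset[of "inversion a ` C"] by simp
qed auto

text \<open>Inverting at a point off both sets sends the intersection, with the point at infinity
  added, to a connected set, which reduces the claim to the compact case.\<close>

lemma Janiszewski_unbounded:
  fixes A B :: "complex set"
  assumes "closed A" "closed B" "A \<inter> B = \<Union>\<C>"
    and \<C>: "\<And>C. C \<in> \<C> \<Longrightarrow> connected C \<and> \<not> bounded C"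
    and ccA: "connected_component (-A) x y" and ccB: "connected_component (-B) x y"
  shows "connected_component (-(A \<union> B)) x y"
proof -
  have "x \<in> -A" "x \<in> -B"
    using connected_component_in ccA ccB by blast+
  then have "open (-(A \<union> B))" "x \<in> -(A \<union> B)"
    using assms by auto
  then have "infinite (-(A \<union> B))"
    using finite_imp_not_open[of "-(A \<union> B)"] by auto
  then have "-(A \<union> B) - {x,y} \<noteq> {}"
    by (intro infinite_imp_nonempty Diff_infinite_finite) auto
  then obtain a where a: "a \<notin> A" "a \<notin> B" "a \<noteq> x" "a \<noteq> y"
    by auto
  let ?S = "insert 0 (inversion a ` A)" and ?T = "insert 0 (inversion a ` B)"
  have "?S \<inter> ?T = insert 0 (inversion a ` (\<Union>\<C>))"
    unfolding assms(3)[symmetric] using image_Int[OF inj_inversion] by auto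
  \<comment> \<open>The extra member \<open>{0}\<close> covers the case of an empty family, where
    the two inverted sets still share the point at infinity.\<close>
  also have "\<dots> = \<Union>(insert {0} ((\<lambda>C. insert 0 (inversion a ` C)) ` \<C>))"
    by auto
  also have "connected \<dots>"
  proof (rule connected_Union)
    fix D assume "D \<in> insert {0} ((\<lambda>C. insert 0 (inversion a ` C)) ` \<C>)"
    then consider "D = {0}" | C where "C \<in> \<C>" "D = insert 0 (inversion a ` C)"
      by auto
    then show "connected D"
    proof cases
      case 2
      then have "a \<notin> C"
        using a assms(3) by auto
      then show ?thesis
        using 2 \<C> connected_insert_0_inversion by simp
    qed auto
  qed auto
  finally have "connected (?S \<inter> ?T)" .
  then have "connected_component (-(?S \<union> ?T)) (inversion a x) (inversion a y)"
    using assms a by (intro Janiszewski compact_inversion_image closed_inversion_image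
        connected_component_inversion) auto
  moreover have "?S \<union> ?T = insert 0 (inversion a ` (A \<union> B))"
    by auto
  ultimately show ?thesis
    using connected_component_inversion_back by metis
qed

subsection \<open>Proper lines separate the plane\<close>

text \<open>Provides a pole off the line. Otherwise properness would put the unit disc into the
  image of a compact interval, on which the line is a homeomorphism, and the inverse would embed an
  open subset of the plane into the real line.\<close>

lemma range_proper_line_neq_UNIV:
  fixes \<psi> :: "real \<Rightarrow> complex"
  assumes cont: "continuous_on UNIV \<psi>" and inj: "inj \<psi>"
    and top: "filterlim \<psi> at_infinity at_top" and bot: "filterlim \<psi> at_infinity at_bot"
  shows "range \<psi> \<noteq> UNIV"
proof
  assume *: "range \<psi> = UNIV"
  have "\<forall>\<^sub>F t in at_top. norm (\<psi> t) \<ge> 1" "\<forall>\<^sub>F t in at_bot. norm (\<psi> t) \<ge> 1"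
    using filterlim_at_infinity[of 0 \<psi>] top bot by fastforce+
  then obtain M N where MN: "\<And>t. t \<ge> M \<Longrightarrow> norm (\<psi> t) \<ge> 1" "\<And>t. t \<le> N \<Longrightarrow> norm (\<psi> t) \<ge> 1"
    unfolding eventually_at_top_linorder eventually_at_bot_linorder by blast
  have sub: "ball 0 1 \<subseteq> \<psi> ` {N..M}"
  proof
    fix z :: complex assume "z \<in> ball 0 1"
    moreover obtain t where "z = \<psi> t"
      using * by blast
    ultimately show "z \<in> \<psi> ` {N..M}"
      using MN(1)[of t] MN(2)[of t] by (cases "t \<ge> M"; cases "t \<le> N") auto
  qed
  obtain g where "homeomorphism {N..M} (\<psi> ` {N..M}) \<psi> g"
    using homeomorphism_compact[of "{N..M}" \<psi>] inj cont by (meson compact_Icc continuous_on_subset inj_on_subset top_greatest)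
  then have "continuous_on (ball 0 1) g" "inj_on g (ball 0 1)"
    using sub by (auto simp: homeomorphism_def intro: continuous_on_subset inj_on_inverseI)
  then have "DIM(complex) \<le> DIM(real)"
    by (intro invariance_of_dimension[of "ball 0 1" g]) auto
  then show False
    by simp
qed

text \<open>The tangent stretches the open unit interval to the real line, and both ends of the line
  are sent to infinity, hence to 0 after inversion. Setting the loop to 0 at both ends of the
  interval makes it continuous, and it returns to 0 nowhere else.\<close>

lemma proper_line_closure_is_loop:
  fixes \<psi> :: "real \<Rightarrow> complex"
  assumes cont: "continuous_on UNIV \<psi>" and inj: "inj \<psi>"
    and top: "filterlim \<psi> at_infinity at_top" and bot: "filterlim \<psi> at_infinity at_bot"
    and a: "a \<notin> range \<psi>"
  obtains c where "simple_path c" "pathfinish c = pathstart c"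
    "path_image c = insert 0 (inversion a ` range \<psi>)"
proof
  define \<sigma> where "\<sigma> = (\<lambda>t. tan (pi * t - pi / 2))"
  define c where "c = (\<lambda>t. if t = 0 \<or> t = 1 then 0 else inversion a (\<psi> (\<sigma> t)))"
  have \<sigma>_arctan: "arctan (\<sigma> t) = pi * t - pi / 2" if "0 < t" "t < 1" for t
    unfolding \<sigma>_def using that by (intro arctan_tan) (auto simp: field_simps)
  have \<sigma>_inv: "\<sigma> ((arctan y + pi / 2) / pi) = y" for y
    unfolding \<sigma>_def by (simp add: tan_arctan)
  have inv_0: "filterlim (inversion a) (nhds 0) at_infinity"
    unfolding inversion_def
    by (rule filterlim_compose[OF tendsto_inverse_0])
      (auto intro!: tendsto_add_filterlim_at_infinity'[of id at_infinity "\<lambda>_. -a", simplified] simp: filterlim_ident id_def)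
  have lin0: "filterlim (\<lambda>t. pi * t - pi / 2) (at_right (-(pi/2))) (at_right 0)"
  proof (subst filterlim_at, intro conjI)
    show "((\<lambda>t. pi * t - pi / 2) \<longlongrightarrow> -(pi/2)) (at_right 0)"
      by (rule tendsto_eq_rhs, (rule tendsto_intros)+) simp
    show "\<forall>\<^sub>F t in at_right 0. pi * t - pi / 2 \<in> {-(pi/2)<..} \<and> pi * t - pi / 2 \<noteq> -(pi/2)"
      by (auto simp: eventually_at_filter)
  qed
  have lin1: "filterlim (\<lambda>t. pi * t - pi / 2) (at_left (pi/2)) (at_left 1)"
  proof (subst filterlim_at, intro conjI)
    show "((\<lambda>t. pi * t - pi / 2) \<longlongrightarrow> pi/2) (at_left 1)"
      by (rule tendsto_eq_rhs, (rule tendsto_intros)+) simp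
    show "\<forall>\<^sub>F t in at_left 1. pi * t - pi / 2 \<in> {..<pi/2} \<and> pi * t - pi / 2 \<noteq> pi/2"
      by (auto simp: eventually_at_filter)
  qed
  have lim0: "filterlim (\<lambda>t. inversion a (\<psi> (\<sigma> t))) (nhds 0) (at_right 0)"
    unfolding \<sigma>_def
    by (intro filterlim_compose[OF inv_0] filterlim_compose[OF bot]
        filterlim_compose[OF filterlim_tan_at_right] lin0)
  have lim1: "filterlim (\<lambda>t. inversion a (\<psi> (\<sigma> t))) (nhds 0) (at_left 1)"
    unfolding \<sigma>_def
    by (intro filterlim_compose[OF inv_0] filterlim_compose[OF top]
        filterlim_compose[OF filterlim_tan_at_left] lin1)
  have "continuous_on {0..1} c"
  proof (rule continuous_on_IccI)
    have "\<forall>\<^sub>F t in at_right 0. inversion a (\<psi> (\<sigma> t)) = c t"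
      using eventually_at_right_real[of 0 "1::real"]
      by (auto simp: c_def elim!: eventually_mono)
    then show "(c \<longlongrightarrow> c 0) (at_right 0)"
      using Lim_transform_eventually[OF lim0] by (simp add: c_def)
    have "\<forall>\<^sub>F t in at_left 1. inversion a (\<psi> (\<sigma> t)) = c t"
      using eventually_at_left_real[of 0 "1::real"]
      by (auto simp: c_def elim!: eventually_mono)
    then show "(c \<longlongrightarrow> c 1) (at_left 1)"
      using Lim_transform_eventually[OF lim1] by (simp add: c_def)
  next
    fix x :: real assume x: "0 < x" "x < 1"
    have "cos (pi * t - pi / 2) \<noteq> 0" if "t \<in> {0<..<1}" for t
      using that cos_gt_zero_pi[of "pi * t - pi / 2"] by (auto simp: field_simps)
    then have "continuous_on {0<..<1} \<sigma>"
      unfolding \<sigma>_def by (auto intro!: continuous_intros)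
    then have "continuous_on {0<..<1} (\<lambda>t. inversion a (\<psi> (\<sigma> t)))"
      using a by (intro continuous_on_compose2[OF continuous_on_inversion[of a "-{a}"]]
          continuous_on_compose2[OF cont]) auto
    then have "continuous_on {0<..<1} c"
      by (rule continuous_on_eq) (auto simp: c_def)
    then show "c \<midarrow>x\<rightarrow> c x"
      using x by (simp add: continuous_on_eq_continuous_at isCont_def)
  qed auto
  moreover have "loop_free c"
  proof -
    have "x = y" if "x \<in> {0<..<1}" "y \<in> {0<..<1}" "c x = c y" for x y
    proof -
      have "\<sigma> x = \<sigma> y"
        using that inj inj_inversion[of a] by (auto simp: c_def dest!: injD)
      then have "arctan (\<sigma> x) = arctan (\<sigma> y)"
        by simp
      then show ?thesis
        using that by (simp add: \<sigma>_arctan)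
    qed
    moreover have "c x \<noteq> 0" if "x \<in> {0<..<1}" for x
      using that a by (auto simp: c_def)
    moreover have "c 0 = 0" "c 1 = 0"
      by (auto simp: c_def)
    ultimately show ?thesis
      unfolding loop_free_def by (metis atLeastAtMost_iff greaterThanLessThan_iff less_eq_real_def)
  qed
  ultimately show "simple_path c"
    by (simp add: simple_path_def path_def)
  show "pathfinish c = pathstart c"
    by (simp add: c_def pathfinish_def pathstart_def)
  have "inversion a (\<psi> y) \<in> c ` {0..1}" for y
  proof -
    have "0 < (arctan y + pi / 2) / pi" "(arctan y + pi / 2) / pi < 1"
      using arctan_bounded[of y] by (auto simp: field_simps)
    then show ?thesis
      using \<sigma>_inv[of y] by (auto simp: c_def image_iff intro!: bexI[of _ "(arctan y + pi / 2) / pi"])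
  qed
  moreover have "0 \<in> c ` {0..1}"
    by (rule image_eqI[of _ _ 0]) (auto simp: c_def)
  moreover have "c ` {0..1} \<subseteq> insert 0 (inversion a ` range \<psi>)"
    by (auto simp: c_def)
  ultimately show "path_image c = insert 0 (inversion a ` range \<psi>)"
    unfolding path_image_def by blast
qed

text \<open>The Jordan curve theorem for the inverted line, carried back by the inverse map
  \<open>g\<close>. Since 0 lies on the curve, \<open>g\<close> is continuous on both the inside and
  the outside.\<close>

lemma proper_line_separates:
  fixes \<psi> :: "real \<Rightarrow> complex"
  assumes cont: "continuous_on UNIV \<psi>" and inj: "inj \<psi>"
    and top: "filterlim \<psi> at_infinity at_top" and bot: "filterlim \<psi> at_infinity at_bot"
  obtains S T where "open S" "open T" "connected S" "connected T" "S \<inter> T = {}"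
    "S \<union> T = - range \<psi>" "frontier S = range \<psi>" "frontier T = range \<psi>"
proof -
  define L where "L = range \<psi>"
  obtain a where a: "a \<notin> L"
    using range_proper_line_neq_UNIV[OF assms] unfolding L_def by blast
  obtain c where c: "simple_path c" "pathfinish c = pathstart c"
    "path_image c = insert 0 (inversion a ` L)"
    using proper_line_closure_is_loop[OF assms] a unfolding L_def by blast
  define J where "J = insert 0 (inversion a ` L)"
  have J: "inside J \<noteq> {}" "open (inside J)" "connected (inside J)" "open (outside J)"
    "connected (outside J)" "bounded (inside J)" "\<not> bounded (outside J)"
    "inside J \<inter> outside J = {}" "inside J \<union> outside J = - J"
    "frontier (inside J) = J" "frontier (outside J) = J"
    using Jordan_inside_outside[OF c(1,2)] unfolding c(3) J_def[symmetric] by auto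
  have bdJ: "bounded J"
    using c(1,3) J_def bounded_simple_path_image by metis
  define g where "g = (\<lambda>w. a + inverse w)"
  have gf: "g (inversion a z) = z" and fg: "inversion a (g w) = w" for z w
    unfolding g_def by (simp_all add: inversion_inverse inversion_of_inverse)
  have cg: "continuous_on (-{0}) g"
    unfolding g_def by (auto intro!: continuous_intros)
  have "0 \<in> J"
    by (simp add: J_def)
  then have n0: "0 \<notin> inside J" "0 \<notin> outside J"
    using J(9) by blast+
  define S where "S = g ` inside J"
  \<comment> \<open>The pole corresponds to the point at infinity of the inverted plane and so is
    missing from the images of both sides; it belongs to the unbounded one.\<close>
  define T where "T = insert a (g ` outside J)"
  have og: "open (g ` U)" if "open U" "0 \<notin> U" for U
  proof -
    have "g ` U = {z. z \<noteq> a \<and> inversion a z \<in> U}"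
      using that(2) gf fg by (auto simp: image_iff) (metis inversion_eq_0_iff)+
    also have "\<dots> = inversion a -` U \<inter> (-{a})"
      by auto
    also have "open \<dots>"
      by (subst Int_commute) (use that in \<open>auto intro!: continuous_open_preimage continuous_on_inversion\<close>)
    finally show ?thesis .
  qed
  have "open S" "open (g ` outside J)"
    using og J n0 unfolding S_def by blast+
  have "connected S" "connected (g ` outside J)"
    unfolding S_def using J n0 by (auto intro!: connected_continuous_image continuous_on_subset[OF cg])
  obtain M where M: "M > 0" "J \<union> inside J \<subseteq> ball 0 M"
    using bdJ J(6) by (metis bounded_Un bounded_subset_ballD)
  \<comment> \<open>A small punctured disc about \<open>a\<close> is inverted to points far out,
    beyond the curve and its inside. This makes \<open>T\<close> open and puts \<open>a\<close> in
    the closure of the image of the outside, so that adding it keeps that image connected.\<close>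
  have near: "z \<in> g ` outside J" if "z \<in> ball a (inverse M)" "z \<noteq> a" for z
  proof -
    have "norm (z - a) < inverse M"
      using that by (simp add: dist_norm norm_minus_commute)
    then have "norm (inversion a z) > M"
      unfolding inversion_def norm_inverse
      using that(2) by (metis inverse_inverse_eq less_imp_inverse_less right_minus_eq zero_less_norm_iff)
    then have "inversion a z \<notin> J \<union> inside J"
      using M(2) by auto
    then have "inversion a z \<in> outside J"
      using J(9) by blast
    then show ?thesis
      using gf by (metis image_eqI)
  qed
  have "open T"
  proof -
    have "ball a (inverse M) - {a} \<subseteq> g ` outside J"
      using near by blast
    moreover have "a \<in> ball a (inverse M)"
      using M(1) by simp
    ultimately have "T = g ` outside J \<union> ball a (inverse M)"
      unfolding T_def by blast
    then show ?thesis
      using \<open>open (g ` outside J)\<close> by auto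
  qed
  have "a \<in> closure (g ` outside J)"
    unfolding closure_approachable
  proof (intro allI impI)
    fix e :: real assume "e > 0"
    define d where "d = min e (inverse M) / 2"
    have "d > 0" "d < e" "d < inverse M"
      using \<open>e > 0\<close> M(1) by (auto simp: d_def min_def field_simps)
    then have "a + of_real d \<in> g ` outside J"
      by (intro near) (auto simp: dist_norm)
    then show "\<exists>y\<in>g ` outside J. dist y a < e"
      using \<open>d < e\<close> \<open>d > 0\<close> by (intro bexI[of _ "a + of_real d"]) (auto simp: dist_norm)
  qed
  then have "connected T"
    unfolding T_def
    by (intro connected_intermediate_closure[OF \<open>connected (g ` outside J)\<close>])
      (use closure_subset[of "g ` outside J"] in auto)
  have memS: "z \<in> S \<longleftrightarrow> inversion a z \<in> inside J" and memT: "z \<in> T \<longleftrightarrow> z = a \<or> inversion a z \<in> outside J" for z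
    unfolding S_def T_def using gf fg by (metis (no_types) imageE imageI insert_iff)+
  have memL: "z \<in> L \<longleftrightarrow> z \<noteq> a \<and> inversion a z \<in> J" for z
    unfolding J_def using a inj_inversion[of a] by (auto dest: injD)
  have inv_a: "inversion a a = 0"
    by simp
  have part: "S \<inter> T = {}" "S \<union> T = -L"
  proof -
    have "\<not> (z \<in> S \<and> z \<in> T)" for z
      using memS[of z] memT[of z] J(8) n0 inv_a by (cases "z = a") (simp, blast)
    then show "S \<inter> T = {}"
      by blast
    have "z \<in> S \<or> z \<in> T \<longleftrightarrow> z \<notin> L" for z
      using memS[of z] memT[of z] memL[of z] J(9) by (cases "z = a") blast+
    then show "S \<union> T = -L"
      by blast
  qed
  have fr: "L \<subseteq> closure (g ` U)" if "frontier U = J" "0 \<notin> U" "open U" for U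
  proof
    fix z assume "z \<in> L"
    then have "inversion a z \<in> closure U" "z \<noteq> a"
      using memL that by (auto simp: frontier_def)
    then obtain u where u: "\<And>n::nat. u n \<in> U" "u \<longlonglongrightarrow> inversion a z"
      unfolding closure_sequential by blast
    have "isCont g (inversion a z)"
      unfolding g_def using \<open>z \<noteq> a\<close> by (auto intro!: continuous_intros)
    then have "(\<lambda>n. g (u n)) \<longlonglongrightarrow> g (inversion a z)"
      using u(2) isCont_tendsto_compose by blast
    then show "z \<in> closure (g ` U)"
      unfolding closure_sequential gf using u(1) by (intro exI[of _ "\<lambda>n. g (u n)"]) auto
  qed
  have front: "frontier S = L" "frontier T = L"
  proof -
    have "closure S \<inter> T = {}" "closure T \<inter> S = {}"
      using part(1) \<open>open S\<close> \<open>open T\<close> by (metis Int_commute open_Int_closure_eq_empty)+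
    moreover have "L \<subseteq> closure S"
      using fr[of "inside J"] J n0 unfolding S_def by auto
    moreover have "closure (g ` outside J) \<subseteq> closure T"
      unfolding T_def by (intro closure_mono) auto
    then have "L \<subseteq> closure T"
      using fr[of "outside J"] J n0 by auto
    ultimately show "frontier S = L" "frontier T = L"
      unfolding frontier_def using part \<open>open S\<close> \<open>open T\<close> by (auto simp: interior_open)
  qed
  show ?thesis
    using that[of S T] \<open>open S\<close> \<open>open T\<close> \<open>connected S\<close> \<open>connected T\<close> part front L_def by blast
qed

text \<open>The arc \<open>g i\<close> is traversed while the parameter runs through the interval
  from \<open>i\<close> to \<open>i + 1\<close>. Hypothesis \<open>meet\<close> yields injectivity:
  a point shared by two arcs is the end of the earlier one, which belongs to the parameter interval
  of the next. Hypothesis \<open>fin\<close> yields properness.\<close>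

lemma concatenated_arcs_proper_line:
  fixes g :: "int \<Rightarrow> real \<Rightarrow> complex"
  assumes arc: "\<And>i. arc (g i)" and link: "\<And>i. pathfinish (g i) = pathstart (g (i + 1))"
    and meet: "\<And>i j x. i < j \<Longrightarrow> x \<in> path_image (g i) \<Longrightarrow> x \<in> path_image (g j) \<Longrightarrow>
      j = i + 1 \<and> x = pathfinish (g i)"
    and fin: "\<And>K. compact K \<Longrightarrow> finite {i. path_image (g i) \<inter> K \<noteq> {}}"
  obtains \<psi> :: "real \<Rightarrow> complex" where "continuous_on UNIV \<psi>" "inj \<psi>"
    "filterlim \<psi> at_infinity at_top" "filterlim \<psi> at_infinity at_bot"
    "range \<psi> = (\<Union>i. path_image (g i))"
proof
  define \<psi> where "\<psi> = (\<lambda>t. g \<lfloor>t\<rfloor> (frac t))"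
  have frac01: "frac t \<in> {0..1}" for t :: real
    using frac_lt_1[of t] by (simp add: less_imp_le)
  have \<psi>_in: "\<psi> t \<in> path_image (g \<lfloor>t\<rfloor>)" for t
    unfolding \<psi>_def path_image_def using frac01 by blast
  have piece: "\<psi> t = g i (t - of_int i)" if "t \<in> {of_int i..of_int i + 1}" for i t
  proof (cases "t = of_int i + 1")
    case True
    then have "t = of_int (i + 1)"
      by simp
    then show ?thesis
      using link[of i] by (simp add: \<psi>_def pathfinish_def pathstart_def)
  next
    case False
    then have "\<lfloor>t\<rfloor> = i"
      using that by (auto simp: floor_eq_iff)
    then show ?thesis
      by (simp add: \<psi>_def frac_def)
  qed
  have cont_piece: "continuous_on {of_int i..of_int i + 1} \<psi>" for i
  proof -
    have "continuous_on {0..1} (g i)"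
      using arc by (simp add: arc_def path_def)
    then have "continuous_on {of_int i..of_int i + 1} (\<lambda>t. g i (t - of_int i))"
      by (rule continuous_on_compose2) (auto intro!: continuous_intros)
    then show ?thesis
      by (rule continuous_on_eq) (simp add: piece)
  qed
  have "isCont \<psi> t" for t
  proof -
    define i where "i = \<lfloor>t\<rfloor>"
    \<comment> \<open>Two neighbouring pieces are glued because an integer \<open>t\<close> is
      interior to neither of them alone.\<close>
    have "continuous_on ({of_int (i - 1)..of_int (i - 1) + 1} \<union> {of_int i..of_int i + 1}) \<psi>"
      by (intro continuous_on_closed_Un cont_piece) auto
    moreover have "{of_int i - 1<..<of_int i + 1} \<subseteq>
        {of_int (i - 1)..of_int (i - 1) + 1} \<union> {of_int i..of_int i + 1::real}"
      by auto
    ultimately have "continuous_on {of_int i - 1<..<of_int i + 1} \<psi>"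
      using continuous_on_subset by blast
    moreover have "t \<in> {of_int i - 1<..<of_int i + 1}"
      unfolding i_def by (auto; linarith)
    ultimately show ?thesis
      by (simp add: continuous_on_eq_continuous_at)
  qed
  then show "continuous_on UNIV \<psi>"
    by (simp add: continuous_at_imp_continuous_on)
  have ne: "\<psi> s \<noteq> \<psi> t" if "s < t" for s t
  proof
    assume eq: "\<psi> s = \<psi> t"
    have inj: "inj_on (g i) {0..1}" for i
      using arc by (simp add: arc_def)
    have "\<lfloor>s\<rfloor> \<le> \<lfloor>t\<rfloor>"
      using that by (simp add: floor_mono)
    then consider "\<lfloor>s\<rfloor> = \<lfloor>t\<rfloor>" | "\<lfloor>s\<rfloor> < \<lfloor>t\<rfloor>"
      unfolding order_le_less by blast
    then show False
    proof cases
      case 1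
      then have "frac s = frac t"
        using eq inj[of "\<lfloor>t\<rfloor>"] frac01 unfolding \<psi>_def by (metis inj_on_eq_iff)
      then show False
        using 1 that by (simp add: frac_def)
    next
      case 2
      then have "\<psi> s = pathfinish (g \<lfloor>s\<rfloor>)"
        using meet[OF 2] \<psi>_in eq by metis
      then have "frac s = 1"
        using inj[of "\<lfloor>s\<rfloor>"] frac01[of s] unfolding \<psi>_def pathfinish_def by (auto dest: inj_onD)
      then show False
        using frac_lt_1[of s] by simp
    qed
  qed
  show "inj \<psi>"
    by (rule injI) (metis ne linorder_less_linear)
  have far: "\<exists>M::int. \<forall>t. \<lfloor>t\<rfloor> > M \<or> \<lfloor>t\<rfloor> < -M \<longrightarrow> r \<le> norm (\<psi> t)" for r
  proof -
    let ?I = "{i. path_image (g i) \<inter> cball 0 r \<noteq> {}}"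
    have "finite (abs ` ?I)"
      using fin by simp
    then obtain M where M: "\<And>i. i \<in> ?I \<Longrightarrow> \<bar>i\<bar> \<le> M"
      using bdd_above_finite[of "abs ` ?I"] unfolding bdd_above_def by blast
    have "r \<le> norm (\<psi> t)" if "\<lfloor>t\<rfloor> > M \<or> \<lfloor>t\<rfloor> < -M" for t
      using M[of "\<lfloor>t\<rfloor>"] that \<psi>_in[of t] by fastforce
    then show ?thesis
      by blast
  qed
  show "filterlim \<psi> at_infinity at_top"
    unfolding filterlim_at_infinity[OF order_refl]
  proof (intro allI impI)
    fix r :: real
    obtain M :: int where "\<And>t. \<lfloor>t\<rfloor> > M \<Longrightarrow> r \<le> norm (\<psi> t)"
      using far[of r] by blast
    then show "\<forall>\<^sub>F t in at_top. r \<le> norm (\<psi> t)"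
      by (intro eventually_at_top_linorderI[of "of_int M + 1"]) (simp add: less_floor_iff)
  qed
  show "filterlim \<psi> at_infinity at_bot"
    unfolding filterlim_at_infinity[OF order_refl]
  proof (intro allI impI)
    fix r :: real
    obtain M :: int where "\<And>t. \<lfloor>t\<rfloor> < -M \<Longrightarrow> r \<le> norm (\<psi> t)"
      using far[of r] by blast
    then show "\<forall>\<^sub>F t in at_bot. r \<le> norm (\<psi> t)"
      unfolding eventually_at_bot_linorder
      by (intro exI[of _ "- of_int M - 1"]) (auto simp: floor_less_iff)
  qed
  show "range \<psi> = (\<Union>i. path_image (g i))"
  proof
    show "range \<psi> \<subseteq> (\<Union>i. path_image (g i))"
      using \<psi>_in by blast
    have "g i u \<in> range \<psi>" if "u \<in> {0..1}" for i u
      using piece[of "of_int i + u" i] that by (metis add_diff_cancel_left' add_left_mono atLeastAtMost_iff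
          le_add_same_cancel1 rangeI)
    then show "(\<Union>i. path_image (g i)) \<subseteq> range \<psi>"
      unfolding path_image_def by blast
  qed
qed

subsection \<open>Geodesics in the tree\<close>

locale trivalent_tree =
  fixes V :: "complex set" and E :: "complex set set"
  assumes tree: "trivalent_planar_tree V E"
begin

lemma edge_arc:
  assumes "e \<in> E"
  shows "\<exists>\<gamma>. arc \<gamma> \<and> path_image \<gamma> = e \<and> e \<inter> V = {pathstart \<gamma>, pathfinish \<gamma>}"
proof -
  have "\<forall>e\<in>E. is_edge_arc V e"
    using tree unfolding trivalent_planar_tree_def by (elim conjE)
  then show ?thesis
    using assms unfolding is_edge_arc_def by simp
qed

lemma edge_ends:
  assumes "e \<in> E"
  shows "\<exists>u w. u \<noteq> w \<and> e \<inter> V = {u, w}"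
proof -
  obtain \<gamma> where "arc \<gamma>" "e \<inter> V = {pathstart \<gamma>, pathfinish \<gamma>}"
    using edge_arc[OF assms] by blast
  then show ?thesis
    using arc_distinct_ends by blast
qed

lemma edges_meet_in_vertices:
  assumes "e \<in> E" "e' \<in> E" "e \<noteq> e'"
  shows "e \<inter> e' \<subseteq> V"
proof -
  have "\<forall>e\<in>E. \<forall>e'\<in>E. e \<noteq> e' \<longrightarrow> e \<inter> e' \<subseteq> V"
    using tree unfolding trivalent_planar_tree_def by (elim conjE)
  then show ?thesis
    using assms by blast
qed

lemma edge_eqI:
  assumes "e \<in> E" "e' \<in> E" "e \<inter> V = e' \<inter> V"
  shows "e = e'"
proof -
  have "\<forall>e\<in>E. \<forall>e'\<in>E. e \<inter> V = e' \<inter> V \<longrightarrow> e = e'"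
    using tree unfolding trivalent_planar_tree_def by (elim conjE)
  then show ?thesis
    using assms by blast
qed

lemma degree_3:
  assumes "v \<in> V"
  shows "card {e \<in> E. v \<in> e} = 3"
proof -
  have "\<forall>v\<in>V. card {e \<in> E. v \<in> e} = 3"
    using tree unfolding trivalent_planar_tree_def by (elim conjE)
  then show ?thesis
    using assms by blast
qed

lemma finite_edges_meeting:
  assumes "compact K"
  shows "finite {e \<in> E. e \<inter> K \<noteq> {}}"
proof -
  have "\<forall>K. compact K \<longrightarrow> finite {e \<in> E. e \<inter> K \<noteq> {}}"
    using tree unfolding trivalent_planar_tree_def by (elim conjE)
  then show ?thesis
    using assms by blast
qed

lemma closed_edge: "e \<in> E \<Longrightarrow> closed e"
  using edge_arc closed_arc_image by metis

lemma connected_edge: "e \<in> E \<Longrightarrow> connected e"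
  using edge_arc connected_arc_image by metis

lemma closed_Union_edges:
  assumes "F \<subseteq> E"
  shows "closed (\<Union>F)"
proof -
  have "\<exists>T. open T \<and> x \<in> T \<and> T \<subseteq> - \<Union>F" if "x \<in> - \<Union>F" for x
  proof -
    define F' where "F' = {e \<in> F. e \<inter> cball x 1 \<noteq> {}}"
    have "finite F'"
      using finite_edges_meeting[of "cball x 1"] assms
      by (auto simp: F'_def intro: finite_subset[rotated])
    then have "closed (\<Union>F')"
      using assms closed_edge by (intro closed_Union) (auto simp: F'_def)
    then have "open (ball x 1 - \<Union>F')"
      by auto
    moreover have "ball x 1 - \<Union>F' \<subseteq> - \<Union>F"
      unfolding F'_def by fastforce
    moreover have "x \<in> ball x 1 - \<Union>F'"
      using that by (auto simp: F'_def)
    ultimately show ?thesis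
      by blast
  qed
  then show ?thesis
    unfolding closed_def by (subst open_subopen) blast
qed

lemma connected_edge_interior: "e \<in> E \<Longrightarrow> connected (e - V)"
proof -
  assume "e \<in> E"
  then obtain \<gamma> where "arc \<gamma>" "path_image \<gamma> = e" "e \<inter> V = {pathstart \<gamma>, pathfinish \<gamma>}"
    using edge_arc by blast
  then have "e - V = path_image \<gamma> - {pathstart \<gamma>, pathfinish \<gamma>}"
    by auto
  then show "connected (e - V)"
    using \<open>arc \<gamma>\<close> by (simp add: arc_imp_simple_path connected_simple_path_endless)
qed

text \<open>A connected set with more than one point has no isolated points, and only the two ends
  are removed. Hence a closed set containing the open edge contains the whole edge.\<close>

lemma edge_subset_closure_interior:
  assumes "e \<in> E"
  shows "e \<subseteq> closure (e - V)"
proof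
  fix x assume "x \<in> e"
  obtain u w where uw: "u \<noteq> w" "e \<inter> V = {u, w}"
    using edge_ends[OF assms] by blast
  then have "\<nexists>a. e = {a}"
    by auto
  then have "x islimpt e"
    using connected_imp_perfect[OF connected_edge[OF assms] \<open>x \<in> e\<close>] by blast
  moreover have "e = (e \<inter> V) \<union> (e - V)"
    by auto
  ultimately have "x islimpt (e - V)"
    using islimpt_Un_finite[of "e \<inter> V" x "e - V"] uw(2) by simp
  then show "x \<in> closure (e - V)"
    by (simp add: closure_def)
qed

lemma edge_interior_nonempty: "e \<in> E \<Longrightarrow> e - V \<noteq> {}"
  using edge_subset_closure_interior[of e] edge_ends[of e] by fastforce

text \<open>\<open>adjacent_vertices\<close> relates any two distinct points of an edge, interior
  ones included. Requiring both to be in \<open>V\<close> recovers the adjacency of the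
  graph.\<close>

definition adj :: "complex \<Rightarrow> complex \<Rightarrow> bool" where
  "adj u w \<longleftrightarrow> u \<in> V \<and> w \<in> V \<and> u \<noteq> w \<and> (\<exists>e\<in>E. u \<in> e \<and> w \<in> e)"

definition edg :: "complex \<Rightarrow> complex \<Rightarrow> complex set" where
  "edg u w = (THE e. e \<in> E \<and> u \<in> e \<and> w \<in> e)"

lemma adj_sym: "adj u w \<Longrightarrow> adj w u"
  by (auto simp: adj_def)

lemma adj_adjacent: "adj u w \<Longrightarrow> adjacent_vertices E u w"
  by (simp add: adj_def adjacent_vertices_def)

lemma adj_neq: "adj u w \<Longrightarrow> u \<noteq> w"
  by (auto simp: adj_def)

lemma edge_Int_V:
  assumes "adj u w" "e \<in> E" "u \<in> e" "w \<in> e"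
  shows "e \<inter> V = {u, w}"
proof -
  obtain a b where "a \<noteq> b" "e \<inter> V = {a, b}"
    using edge_ends[OF assms(2)] by blast
  moreover have "u \<in> e \<inter> V" "w \<in> e \<inter> V" "u \<noteq> w"
    using assms by (auto simp: adj_def)
  ultimately have "u = a \<and> w = b \<or> u = b \<and> w = a"
    by auto
  then show ?thesis
    using \<open>e \<inter> V = {a, b}\<close> by auto
qed

lemma edg_eqI:
  assumes "adj u w" "e \<in> E" "u \<in> e" "w \<in> e"
  shows "edg u w = e"
  unfolding edg_def using assms edge_Int_V edge_eqI by (intro the_equality) metis+

lemma edg_props:
  assumes "adj u w"
  shows "edg u w \<in> E" "u \<in> edg u w" "w \<in> edg u w" "edg u w \<inter> V = {u, w}"
proof -
  obtain e where e: "e \<in> E" "u \<in> e" "w \<in> e"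
    using assms by (auto simp: adj_def)
  then have "edg u w = e"
    using assms edg_eqI by blast
  then show "edg u w \<in> E" "u \<in> edg u w" "w \<in> edg u w" "edg u w \<inter> V = {u, w}"
    using e edge_Int_V assms by auto
qed

lemma edg_commute: "adj u w \<Longrightarrow> edg u w = edg w u"
  using edg_eqI[of u w "edg w u"] edg_props[of w u] adj_sym by blast

lemma edge_eq_edg:
  assumes "e \<in> E" "v \<in> e" "v \<in> V"
  obtains w where "adj v w" "e = edg v w"
proof -
  obtain u w where "u \<noteq> w" "e \<inter> V = {u, w}"
    using edge_ends[OF assms(1)] by blast
  then obtain w' where "adj v w'" "w' \<in> e"
    using assms unfolding adj_def by (metis Int_iff insert_iff singletonD)
  then show ?thesis
    using that edg_eqI assms by metis
qed

lemma edg_meet: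
  assumes "adj a b" "adj c d" "x \<in> edg a b" "x \<in> edg c d"
  shows "{a, b} = {c, d} \<or> x \<in> {a, b} \<and> x \<in> {c, d}"
proof (cases "edg a b = edg c d")
  case True
  then show ?thesis
    using edg_props(4) assms by metis
next
  case False
  then have "x \<in> V"
    using edges_meet_in_vertices edg_props(1) assms by blast
  then show ?thesis
    using edg_props(4) assms by blast
qed

lemma three_neighbours:
  assumes "v \<in> V"
  obtains w1 w2 w3 where "adj v w1" "adj v w2" "adj v w3" "w1 \<noteq> w2" "w1 \<noteq> w3" "w2 \<noteq> w3"
    "{e \<in> E. v \<in> e} = {edg v w1, edg v w2, edg v w3}"
proof -
  obtain e1 e2 e3 where e: "{e \<in> E. v \<in> e} = {e1, e2, e3}" "e1 \<noteq> e2" "e1 \<noteq> e3" "e2 \<noteq> e3"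
    using degree_3[OF assms] unfolding card_3_iff by metis
  then have "e1 \<in> E" "v \<in> e1" "e2 \<in> E" "v \<in> e2" "e3 \<in> E" "v \<in> e3"
    by blast+
  then obtain w1 w2 w3 where "adj v w1" "e1 = edg v w1" "adj v w2" "e2 = edg v w2"
    "adj v w3" "e3 = edg v w3"
    using edge_eq_edg assms by metis
  then show ?thesis
    using that[of w1 w2 w3] e by blast
qed

lemma another_neighbour:
  assumes "v \<in> V"
  obtains w where "adj v w" "w \<noteq> a" "w \<noteq> b"
proof -
  obtain w1 w2 w3 where "adj v w1" "adj v w2" "adj v w3" "w1 \<noteq> w2" "w1 \<noteq> w3" "w2 \<noteq> w3"
    using three_neighbours[OF assms] by metis
  then show ?thesis
    using that by metis
qed

lemma adj_in_V: "adj u w \<Longrightarrow> u \<in> V" "adj u w \<Longrightarrow> w \<in> V"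
  by (auto simp: adj_def)

section \<open>Geodesics and rays as vertex sequences\<close>

definition geodesic :: "(int \<Rightarrow> complex) \<Rightarrow> bool" where
  "geodesic l \<longleftrightarrow> (\<forall>i. adj (l i) (l (i + 1)) \<and> l (i + 2) \<noteq> l i)"

definition ray :: "(nat \<Rightarrow> complex) \<Rightarrow> bool" where
  "ray \<rho> \<longleftrightarrow> (\<forall>n. adj (\<rho> n) (\<rho> (Suc n)) \<and> \<rho> (Suc (Suc n)) \<noteq> \<rho> n)"

text \<open>A shortest return is a cycle: its vertices are distinct because any earlier coincidence
  would be a shorter return, possibly from another starting index, and its length is at least 3
  because neighbours differ and there is no backtracking.\<close>

lemma geodesic_no_return:
  assumes "geodesic l" "d > 0"
  shows "l (i + int d) \<noteq> l i"
  using assms(2)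
proof (induction d arbitrary: i rule: less_induct)
  case (less d)
  show ?case
  proof
    assume eq: "l (i + int d) = l i"
    have adj: "adj (l j) (l (j + 1))" and nb: "l (j + 2) \<noteq> l j" for j
      using assms(1) by (auto simp: geodesic_def)
    have "d \<noteq> 1"
      using adj_neq[OF adj[of i]] eq by auto
    moreover have "d \<noteq> 2"
      using nb[of i] eq by auto
    ultimately have d3: "d \<ge> 3"
      using less.prems by linarith
    define vs where "vs = map (\<lambda>k. l (i + int k)) [0..<d]"
    have ne: "l (i + int j) \<noteq> l (i + int k)" if "j < k" "k < d" for j k
    proof -
      have "k - j < d" "0 < k - j" "i + int j + int (k - j) = i + int k"
        using that by auto
      then show ?thesis
        using less.IH[of "k - j" "i + int j"] by metis
    qed
    have "inj_on (\<lambda>k. l (i + int k)) {0..<d}"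
      by (rule linorder_inj_onI) (use ne in auto)
    then have "distinct vs"
      by (simp add: vs_def distinct_map)
    moreover have "length vs = d"
      by (simp add: vs_def)
    moreover have "set vs \<subseteq> V"
      using adj_in_V(1)[OF adj] by (auto simp: vs_def)
    moreover have "adjacent_vertices E (vs ! k) (vs ! Suc k)" if "Suc k < length vs" for k
    proof -
      have "vs ! k = l (i + int k)" "vs ! Suc k = l (i + int k + 1)"
        using that by (simp_all add: vs_def algebra_simps)
      then show ?thesis
        using adj_adjacent[OF adj] by simp
    qed
    moreover have "adjacent_vertices E (last vs) (hd vs)"
    proof -
      have "last vs = l (i + int (d - 1))" "hd vs = l i"
        using d3 by (simp_all add: vs_def last_map hd_map)
      moreover have "l (i + int (d - 1) + 1) = l i"
        using eq d3 by (simp add: of_nat_diff)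
      ultimately show ?thesis
        using adj_adjacent[OF adj[of "i + int (d - 1)"]] by simp
    qed
    ultimately have "has_cycle V E"
      unfolding has_cycle_def using d3 by blast
    moreover have "\<not> has_cycle V E"
      using tree unfolding trivalent_planar_tree_def by (elim conjE)
    ultimately show False
      by contradiction
  qed
qed

lemma geodesic_inj:
  assumes "geodesic l"
  shows "inj l"
proof (rule injI)
  have *: "l i \<noteq> l j" if "i < j" for i j
    using geodesic_no_return[OF assms, of "nat (j - i)" i] that by auto
  fix i j assume "l i = l j"
  then show "i = j"
    using *[of i j] *[of j i] by (cases i j rule: linorder_cases) auto
qed

text \<open>Comes in along the second ray, reversed onto the negative indices, and leaves along the
  first. Index 0 is read from the first ray, so the two starting points must agree.\<close>

definition joined :: "(nat \<Rightarrow> complex) \<Rightarrow> (nat \<Rightarrow> complex) \<Rightarrow> int \<Rightarrow> complex" where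
  "joined \<rho> \<sigma> i = (if i \<ge> 0 then \<rho> (nat i) else \<sigma> (nat (- i)))"

text \<open>Starting along different edges is exactly what makes the joined sequence free of
  backtracking at index 0. Every geodesic is used in this form, since the argument needs its two
  halves separately.\<close>

definition forked :: "(nat \<Rightarrow> complex) \<Rightarrow> (nat \<Rightarrow> complex) \<Rightarrow> bool" where
  "forked \<rho> \<sigma> \<longleftrightarrow> ray \<rho> \<and> ray \<sigma> \<and> \<rho> 0 = \<sigma> 0 \<and> \<rho> (Suc 0) \<noteq> \<sigma> (Suc 0)"

lemma forked_sym: "forked \<rho> \<sigma> \<Longrightarrow> forked \<sigma> \<rho>"
  by (auto simp: forked_def)

lemma geodesic_joined:
  assumes "forked \<rho> \<sigma>"
  shows "geodesic (joined \<rho> \<sigma>)"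
  unfolding geodesic_def
proof
  have \<rho>: "adj (\<rho> n) (\<rho> (Suc n))" "\<rho> (Suc (Suc n)) \<noteq> \<rho> n"
    and \<sigma>: "adj (\<sigma> n) (\<sigma> (Suc n))" "\<sigma> (Suc (Suc n)) \<noteq> \<sigma> n" for n
    using assms by (auto simp: forked_def ray_def)
  have 0: "\<rho> 0 = \<sigma> 0" "\<rho> (Suc 0) \<noteq> \<sigma> (Suc 0)"
    using assms by (auto simp: forked_def)
  fix i :: int
  consider n where "i = int n" | "i = -1" | n where "i = - int (Suc (Suc n))"
    by (metis int_cases2 nat.exhaust of_nat_1 One_nat_def of_nat_0 minus_zero)
  then show "adj (joined \<rho> \<sigma> i) (joined \<rho> \<sigma> (i + 1)) \<and> joined \<rho> \<sigma> (i + 2) \<noteq> joined \<rho> \<sigma> i"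
  proof cases
    case (1 n)
    then have "joined \<rho> \<sigma> i = \<rho> n" "joined \<rho> \<sigma> (i + 1) = \<rho> (Suc n)" "joined \<rho> \<sigma> (i + 2) = \<rho> (Suc (Suc n))"
      by (simp_all add: joined_def nat_add_distrib)
    then show ?thesis
      using \<rho> by simp
  next
    case 2
    then have "joined \<rho> \<sigma> i = \<sigma> (Suc 0)" "joined \<rho> \<sigma> (i + 1) = \<sigma> 0" "joined \<rho> \<sigma> (i + 2) = \<rho> (Suc 0)"
      using 0 by (simp_all add: joined_def)
    then show ?thesis
      using \<sigma>(1)[of 0] 0 adj_sym by simp
  next
    case (3 n)
    have "joined \<rho> \<sigma> i = \<sigma> (Suc (Suc n))" "joined \<rho> \<sigma> (i + 1) = \<sigma> (Suc n)"
      using 3 by (simp_all add: joined_def nat_add_distrib)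
    moreover have "joined \<rho> \<sigma> (i + 2) = \<sigma> n"
      using 3 0 by (cases n) (simp_all add: joined_def nat_add_distrib)
    ultimately show ?thesis
      using \<sigma>(1)[of "Suc n"] \<sigma>(2)[of n] adj_sym by simp
  qed
qed

lemma forked_disjoint:
  assumes "forked \<rho> \<sigma>" "\<rho> m = \<sigma> n"
  shows "m = 0" "n = 0"
proof -
  have "joined \<rho> \<sigma> (int m) = joined \<rho> \<sigma> (- int n)"
    using assms by (auto simp: joined_def forked_def)
  then have "int m = - int n"
    using geodesic_inj[OF geodesic_joined[OF assms(1)]] by (auto dest: injD)
  then show "m = 0" "n = 0"
    by auto
qed

lemma ray_exists:
  assumes "adj u w"
  obtains \<rho> where "ray \<rho>" "\<rho> 0 = u" "\<rho> (Suc 0) = w"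
proof -
  \<comment> \<open>The state is the pair of the last two vertices, so that the choice of the next
    neighbour can avoid going back.\<close>
  define f where "f n = ((\<lambda>(a, b). (b, SOME c. adj b c \<and> c \<noteq> a)) ^^ n) (u, w)" for n :: nat
  have step: "f (Suc n) = (snd (f n), SOME c. adj (snd (f n)) c \<and> c \<noteq> fst (f n))" for n
    by (simp add: f_def case_prod_beta)
  have succ: "adj b (SOME c. adj b c \<and> c \<noteq> a) \<and> (SOME c. adj b c \<and> c \<noteq> a) \<noteq> a" if "b \<in> V" for a b
    using someI_ex[of "\<lambda>c. adj b c \<and> c \<noteq> a"] another_neighbour[OF that] by metis
  have "f 0 = (u, w)"
    by (simp add: f_def)
  have adj_f: "adj (fst (f n)) (snd (f n))" for n
    using assms \<open>f 0 = (u, w)\<close> succ adj_in_V by (induction n) (auto simp: step)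
  have f: "f 0 = (u, w)" "\<And>n. adj (fst (f n)) (snd (f n))"
    "\<And>n. fst (f (Suc n)) = snd (f n)" "\<And>n. snd (f (Suc n)) \<noteq> fst (f n)"
    using \<open>f 0 = (u, w)\<close> adj_f succ[OF adj_in_V(2)[OF adj_f]] by (auto simp: step)
  show ?thesis
    using f by (intro that[of "\<lambda>n. fst (f n)"]) (auto simp: ray_def)
qed

lemma forked_exists:
  assumes "ray \<rho>"
  obtains \<sigma> where "forked \<rho> \<sigma>"
proof -
  have "\<rho> 0 \<in> V"
    using assms adj_in_V by (auto simp: ray_def)
  then obtain w where "adj (\<rho> 0) w" "w \<noteq> \<rho> (Suc 0)"
    using another_neighbour by metis
  moreover obtain \<sigma> where "ray \<sigma>" "\<sigma> 0 = \<rho> 0" "\<sigma> (Suc 0) = w"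
    using ray_exists[OF \<open>adj (\<rho> 0) w\<close>] by metis
  ultimately show ?thesis
    using that assms unfolding forked_def by metis
qed

lemma ray_inj:
  assumes "ray \<rho>"
  shows "inj \<rho>"
proof (rule injI)
  obtain \<sigma> where "forked \<rho> \<sigma>"
    using forked_exists[OF assms] .
  then have *: "inj (joined \<rho> \<sigma>)"
    using geodesic_inj geodesic_joined by blast
  fix m n assume "\<rho> m = \<rho> n"
  then have "joined \<rho> \<sigma> (int m) = joined \<rho> \<sigma> (int n)"
    by (simp add: joined_def)
  then show "m = n"
    using * by (auto dest: injD)
qed

lemma ray_tail: "ray \<rho> \<Longrightarrow> ray (\<lambda>n. \<rho> (Suc n))"
  by (simp add: ray_def)

section \<open>Rays and geodesics as subsets of the plane\<close>

definition body :: "(nat \<Rightarrow> complex) \<Rightarrow> complex set" where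
  "body \<rho> = (\<Union>n. edg (\<rho> n) (\<rho> (Suc n)))"

lemma ray_adj: "ray \<rho> \<Longrightarrow> adj (\<rho> n) (\<rho> (Suc n))"
  by (simp add: ray_def)

lemma ray_edge_in_E: "ray \<rho> \<Longrightarrow> edg (\<rho> n) (\<rho> (Suc n)) \<in> E"
  by (simp add: ray_adj edg_props)

lemma ray_edge_inj:
  assumes "ray \<rho>"
  shows "inj (\<lambda>n. edg (\<rho> n) (\<rho> (Suc n)))"
proof (rule injI)
  fix m n assume "edg (\<rho> m) (\<rho> (Suc m)) = edg (\<rho> n) (\<rho> (Suc n))"
  then have "{\<rho> m, \<rho> (Suc m)} = {\<rho> n, \<rho> (Suc n)}"
    using edg_props(4) ray_adj[OF assms] by metis
  moreover have "\<rho> i = \<rho> j \<longleftrightarrow> i = j" for i j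
    using ray_inj[OF assms] by (auto dest: injD)
  ultimately show "m = n"
    by (auto simp: doubleton_eq_iff)
qed

lemma body_eq: "body \<rho> = edg (\<rho> 0) (\<rho> (Suc 0)) \<union> body (\<lambda>n. \<rho> (Suc n))"
proof -
  have "(\<Union>n. edg (\<rho> n) (\<rho> (Suc n))) = edg (\<rho> 0) (\<rho> (Suc 0)) \<union> (\<Union>n. edg (\<rho> (Suc n)) (\<rho> (Suc (Suc n))))"
    by (subst UNIV_nat_eq) auto
  then show ?thesis
    by (simp add: body_def)
qed

lemma ray_vertex_in_body: "ray \<rho> \<Longrightarrow> \<rho> n \<in> body \<rho>"
  unfolding body_def using edg_props(2)[OF ray_adj[of \<rho> n]] by blast

lemma connected_body:
  assumes "ray \<rho>"
  shows "connected (body \<rho>)"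
proof -
  let ?e = "\<lambda>n. edg (\<rho> n) (\<rho> (Suc n))"
  have "connected (\<Union>n\<le>N. ?e n)" for N
  proof (induction N)
    case 0
    then show ?case
      using connected_edge ray_edge_in_E[OF assms] by simp
  next
    case (Suc N)
    have "\<rho> (Suc N) \<in> (\<Union>n\<le>N. ?e n) \<inter> ?e (Suc N)"
      using edg_props(3)[OF ray_adj[OF assms, of N]] edg_props(2)[OF ray_adj[OF assms, of "Suc N"]] by auto
    then have "connected ((\<Union>n\<le>N. ?e n) \<union> ?e (Suc N))"
      using connected_edge ray_edge_in_E[OF assms] Suc by (intro connected_Un) auto
    then show ?case
      by (simp add: atMost_Suc Un_commute)
  qed
  moreover have "\<rho> 0 \<in> (\<Union>n\<le>N. ?e n)" for N
    using edg_props(2)[OF ray_adj[OF assms, of 0]] by blast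
  then have "\<rho> 0 \<in> (\<Inter>N. \<Union>n\<le>N. ?e n)"
    by (rule INT_I)
  ultimately have "connected (\<Union>N. \<Union>n\<le>N. ?e n)"
    by (intro connected_Union) blast+
  moreover have "(\<Union>N. \<Union>n\<le>N. ?e n) = body \<rho>"
    unfolding body_def by auto
  ultimately show ?thesis
    by simp
qed

text \<open>Local finiteness at work: the infinitely many distinct edges of a bounded ray would all
  meet one compact set.\<close>

lemma unbounded_body:
  assumes "ray \<rho>"
  shows "\<not> bounded (body \<rho>)"
proof
  assume "bounded (body \<rho>)"
  then have "compact (closure (body \<rho>))"
    by simp
  then have "finite {e \<in> E. e \<inter> closure (body \<rho>) \<noteq> {}}"
    by (rule finite_edges_meeting)
  moreover have "range (\<lambda>n. edg (\<rho> n) (\<rho> (Suc n))) \<subseteq> {e \<in> E. e \<inter> closure (body \<rho>) \<noteq> {}}"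
  proof
    fix e assume "e \<in> range (\<lambda>n. edg (\<rho> n) (\<rho> (Suc n)))"
    then obtain n where n: "e = edg (\<rho> n) (\<rho> (Suc n))"
      by blast
    then have "\<rho> n \<in> e" "e \<in> E"
      using edg_props(1,2)[OF ray_adj[OF assms, of n]] by auto
    moreover have "\<rho> n \<in> closure (body \<rho>)"
      using ray_vertex_in_body[OF assms] closure_subset by blast
    ultimately show "e \<in> {e \<in> E. e \<inter> closure (body \<rho>) \<noteq> {}}"
      by blast
  qed
  ultimately have "finite (range (\<lambda>n. edg (\<rho> n) (\<rho> (Suc n))))"
    using finite_subset by blast
  then show False
    using ray_edge_inj[OF assms] finite_imageD infinite_UNIV_nat by blast
qed

lemma forked_bodies_meet:
  assumes "forked \<rho> \<sigma>"
  shows "body \<rho> \<inter> body \<sigma> = {\<rho> 0}"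
proof -
  have rays: "ray \<rho>" "ray \<sigma>" "\<rho> 0 = \<sigma> 0"
    using assms by (auto simp: forked_def)
  have "x = \<rho> 0" if "x \<in> edg (\<rho> m) (\<rho> (Suc m))" "x \<in> edg (\<sigma> n) (\<sigma> (Suc n))" for x m n
  proof -
    have "\<rho> (Suc m) \<noteq> \<sigma> k" for k
      using forked_disjoint[OF assms, of "Suc m" k] by auto
    then have "x \<in> {\<rho> m, \<rho> (Suc m)}" "x \<in> {\<sigma> n, \<sigma> (Suc n)}"
      using edg_meet[OF ray_adj[OF rays(1)] ray_adj[OF rays(2)] that] by blast+
    then obtain i j where "x = \<rho> i" "x = \<sigma> j"
      by blast
    then show ?thesis
      using forked_disjoint[OF assms, of i j] by simp
  qed
  then have "body \<rho> \<inter> body \<sigma> \<subseteq> {\<rho> 0}"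
    unfolding body_def by blast
  moreover have "\<rho> 0 \<in> body \<rho>" "\<rho> 0 \<in> body \<sigma>"
    using ray_vertex_in_body[of \<rho> 0] ray_vertex_in_body[of \<sigma> 0] rays by auto
  ultimately show ?thesis
    by blast
qed

lemma oriented_arc:
  assumes "adj u w"
  shows "\<exists>\<gamma>. arc \<gamma> \<and> path_image \<gamma> = edg u w \<and> pathstart \<gamma> = u \<and> pathfinish \<gamma> = w"
proof -
  obtain \<gamma> where \<gamma>: "arc \<gamma>" "path_image \<gamma> = edg u w" "edg u w \<inter> V = {pathstart \<gamma>, pathfinish \<gamma>}"
    using edge_arc[OF edg_props(1)[OF assms]] by blast
  have "{pathstart \<gamma>, pathfinish \<gamma>} = {u, w}"
    using \<gamma>(3) edg_props(4)[OF assms] by simp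
  then consider "pathstart \<gamma> = u" "pathfinish \<gamma> = w" | "pathstart \<gamma> = w" "pathfinish \<gamma> = u"
    by (auto simp: doubleton_eq_iff)
  then show ?thesis
  proof cases
    case 1
    then show ?thesis
      using \<gamma> by blast
  next
    case 2
    then show ?thesis
      using \<gamma> by (intro exI[of _ "reversepath \<gamma>"]) (simp add: arc_reversepath)
  qed
qed

lemma joined_edges:
  assumes "forked \<rho> \<sigma>"
  shows "(\<Union>i. edg (joined \<rho> \<sigma> i) (joined \<rho> \<sigma> (i + 1))) = body \<rho> \<union> body \<sigma>"
proof -
  have rays: "ray \<rho>" "ray \<sigma>" "\<rho> 0 = \<sigma> 0"
    using assms by (auto simp: forked_def)
  have pos: "edg (joined \<rho> \<sigma> (int n)) (joined \<rho> \<sigma> (int n + 1)) = edg (\<rho> n) (\<rho> (Suc n))" for n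
    by (simp add: joined_def nat_add_distrib)
  have neg_edge: "edg (joined \<rho> \<sigma> (- int (Suc n))) (joined \<rho> \<sigma> (- int (Suc n) + 1)) = edg (\<sigma> n) (\<sigma> (Suc n))" for n
  proof -
    have "joined \<rho> \<sigma> (- int (Suc n)) = \<sigma> (Suc n)"
      by (simp add: joined_def nat_add_distrib)
    moreover have "joined \<rho> \<sigma> (- int (Suc n) + 1) = \<sigma> n"
      using rays(3) by (cases n) (simp_all add: joined_def nat_add_distrib)
    ultimately show ?thesis
      using edg_commute[OF ray_adj[OF rays(2)]] by simp
  qed
  have "edg (joined \<rho> \<sigma> i) (joined \<rho> \<sigma> (i + 1)) \<subseteq> body \<rho> \<union> body \<sigma>" for i
  proof (cases i rule: int_cases)
    case (nonneg n)
    then show ?thesis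
      using pos[of n] by (auto simp: body_def)
  next
    case (neg n)
    then show ?thesis
      using neg_edge[of n] by (auto simp: body_def)
  qed
  moreover have "body \<rho> \<subseteq> (\<Union>i. edg (joined \<rho> \<sigma> i) (joined \<rho> \<sigma> (i + 1)))"
    unfolding body_def using pos by blast
  moreover have "body \<sigma> \<subseteq> (\<Union>i. edg (joined \<rho> \<sigma> i) (joined \<rho> \<sigma> (i + 1)))"
    unfolding body_def using neg_edge by blast
  ultimately show ?thesis
    by blast
qed

lemma line_separates:
  assumes "forked \<rho> \<sigma>"
  obtains S T where "open S" "open T" "connected S" "connected T" "S \<inter> T = {}"
    "S \<union> T = - (body \<rho> \<union> body \<sigma>)" "frontier S = body \<rho> \<union> body \<sigma>" "frontier T = body \<rho> \<union> body \<sigma>"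
proof -
  define l where "l = joined \<rho> \<sigma>"
  have l: "geodesic l" "inj l"
    using geodesic_joined[OF assms] geodesic_inj unfolding l_def by auto
  have adj: "adj (l i) (l (i + 1))" for i
    using l(1) by (simp add: geodesic_def)
  obtain g where g: "\<And>i. arc (g i)" "\<And>i. path_image (g i) = edg (l i) (l (i + 1))"
    "\<And>i. pathstart (g i) = l i" "\<And>i. pathfinish (g i) = l (i + 1)"
    using oriented_arc[OF adj] by metis
  have meet: "j = i + 1 \<and> x = pathfinish (g i)"
    if "i < j" "x \<in> path_image (g i)" "x \<in> path_image (g j)" for i j x
  proof -
    have "{l i, l (i + 1)} = {l j, l (j + 1)} \<or> x \<in> {l i, l (i + 1)} \<and> x \<in> {l j, l (j + 1)}"
      using edg_meet[OF adj adj] that g(2) by blast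
    moreover have "l a = l b \<longleftrightarrow> a = b" for a b
      using l(2) by (auto dest: injD)
    ultimately show ?thesis
      using that(1) g(4)[of i] by (auto simp: doubleton_eq_iff)
  qed
  \<comment> \<open>Different indices give different edges, so local finiteness of the tree bounds
    the number of indices as well.\<close>
  have fin: "finite {i. path_image (g i) \<inter> K \<noteq> {}}" if "compact K" for K
  proof (rule inj_on_finite[OF _ _ finite_edges_meeting[OF that]])
    show "inj_on (\<lambda>i. edg (l i) (l (i + 1))) {i. path_image (g i) \<inter> K \<noteq> {}}"
    proof (rule inj_onI)
      fix i j assume "edg (l i) (l (i + 1)) = edg (l j) (l (j + 1))"
      then have "{l i, l (i + 1)} = {l j, l (j + 1)}"
        using edg_props(4)[OF adj] by metis
      moreover have "l a = l b \<longleftrightarrow> a = b" for a b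
        using l(2) by (auto dest: injD)
      ultimately show "i = j"
        by (auto simp: doubleton_eq_iff)
    qed
    show "(\<lambda>i. edg (l i) (l (i + 1))) ` {i. path_image (g i) \<inter> K \<noteq> {}} \<subseteq> {e \<in> E. e \<inter> K \<noteq> {}}"
      using g(2) edg_props(1)[OF adj] by auto
  qed
  obtain \<psi> :: "real \<Rightarrow> complex" where \<psi>: "continuous_on UNIV \<psi>" "inj \<psi>"
    "filterlim \<psi> at_infinity at_top" "filterlim \<psi> at_infinity at_bot"
    "range \<psi> = (\<Union>i. path_image (g i))"
    using concatenated_arcs_proper_line[of g] g meet fin by metis
  have "range \<psi> = body \<rho> \<union> body \<sigma>"
    using \<psi>(5) joined_edges[OF assms] g(2) unfolding l_def by simp
  then show ?thesis
    using proper_line_separates[OF \<psi>(1-4)] that by metis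
qed

subsection \<open>Regions along edges and around vertices\<close>

text \<open>The whole tree, cut along the open part of the edges in \<open>F\<close>, is joined up at infinity;
  hence points of \<open>G\<close> are separated by the tree only if they are separated by the sub-tree
  spanned by \<open>FA\<close>.\<close>

lemma component_on_side:
  assumes FA: "F \<subseteq> FA" "FA \<subseteq> E"
    and meet: "\<Union>FA \<inter> \<Union>(E - F) = \<Union>\<C>" and \<C>: "\<And>C. C \<in> \<C> \<Longrightarrow> connected C \<and> \<not> bounded C"
    and G: "open G" "connected G" "G \<inter> \<Union>(E - F) = {}"
    and S: "connected S" "S \<subseteq> - \<Union>FA"
    and D: "D \<subseteq> closure S \<inter> G" "D \<noteq> {}"
  obtains R where "R \<in> components (- \<Union>E)" "S \<inter> G \<subseteq> R" "S \<inter> G \<noteq> {}" "D \<subseteq> closure R"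
proof -
  have E: "\<Union>E = \<Union>FA \<union> \<Union>(E - F)"
    using FA by blast
  \<comment> \<open>\<open>S\<close> joins the two points off the edges of \<open>FA\<close>, and
    \<open>G\<close> joins them off the edges outside \<open>F\<close>. Together these are all the
    edges, and their overlap is made of unbounded connected pieces.\<close>
  have same: "connected_component (- \<Union>E) x y" if "x \<in> S \<inter> G" "y \<in> S \<inter> G" for x y
    unfolding E
  proof (rule Janiszewski_unbounded[OF _ _ meet])
    show "closed (\<Union>FA)" "closed (\<Union>(E - F))"
      using FA by (auto intro: closed_Union_edges)
    show "connected_component (- \<Union>FA) x y"
      using S that unfolding connected_component_def by blast
    show "connected_component (- \<Union>(E - F)) x y"
      unfolding connected_component_def using G that by (intro exI[of _ G]) blast
  qed (use \<C> in blast)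
  \<comment> \<open>\<open>G\<close> is open, so points of \<open>D\<close> are approached from
    \<open>S\<close> without leaving \<open>G\<close>.\<close>
  have near: "\<exists>y\<in>S \<inter> G. y \<in> U" if "x \<in> D" "open U" "x \<in> U" for x U
  proof -
    have "x \<in> closure S" "x \<in> G \<inter> U" "open (G \<inter> U)"
      using that D G by auto
    then show ?thesis
      using open_Int_closure_eq_empty[of "G \<inter> U" S] by blast
  qed
  obtain y where y: "y \<in> S \<inter> G"
    using near[of _ UNIV] D(2) by blast
  define R where "R = connected_component_set (- \<Union>E) y"
  have "y \<in> - \<Union>E"
    using y S(2) G(3) E by blast
  then have "R \<in> components (- \<Union>E)"
    unfolding R_def components_def by blast
  moreover have sub: "S \<inter> G \<subseteq> R"
    unfolding R_def using same[OF y] by blast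
  moreover have "D \<subseteq> closure R"
  proof
    fix x assume "x \<in> D"
    have "R \<inter> U \<noteq> {}" if "x \<in> U" "open U" for U
      using near[OF \<open>x \<in> D\<close> that(2,1)] sub by blast
    then show "x \<in> closure R"
      unfolding closure_iff_nhds_not_empty by blast
  qed
  ultimately show ?thesis
    using that[of R] y by blast
qed

lemma component_subset_side:
  assumes "R \<in> components (- \<Union>E)" "- \<Union>E \<subseteq> S \<union> T" "open S" "open T" "S \<inter> T = {}" "R \<inter> S \<noteq> {}"
  shows "R \<subseteq> S"
proof -
  have "connected R" "R \<subseteq> S \<union> T"
    using assms in_components_connected in_components_subset by blast+
  then have "R \<inter> T = {}"
    using connectedD[of R S T] assms by blast
  then show ?thesis
    using \<open>R \<subseteq> S \<union> T\<close> by blast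
qed

section \<open>The two regions along an edge\<close>

definition ray_edges :: "(nat \<Rightarrow> complex) \<Rightarrow> complex set set" where
  "ray_edges \<rho> = range (\<lambda>n. edg (\<rho> n) (\<rho> (Suc n)))"

lemma Union_ray_edges: "\<Union>(ray_edges \<rho>) = body \<rho>"
  by (simp add: ray_edges_def body_def)

lemma ray_edges_subset: "ray \<rho> \<Longrightarrow> ray_edges \<rho> \<subseteq> E"
  using ray_edge_in_E[of \<rho>] by (auto simp: ray_edges_def)

lemma first_edge_in_ray_edges: "edg (\<rho> 0) (\<rho> (Suc 0)) \<in> ray_edges \<rho>"
  by (auto simp: ray_edges_def)

lemma vertex_notin_edg:
  assumes "adj a b" "v \<in> V" "v \<noteq> a" "v \<noteq> b"
  shows "v \<notin> edg a b"
  using edg_props(4)[OF assms(1)] assms by blast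

lemma tail_avoids_start:
  assumes "ray \<rho>"
  shows "\<rho> 0 \<notin> edg (\<rho> (Suc n)) (\<rho> (Suc (Suc n)))"
proof (rule vertex_notin_edg)
  have inj: "\<rho> i = \<rho> j \<longleftrightarrow> i = j" for i j
    using ray_inj[OF assms] by (auto dest: injD)
  show "\<rho> 0 \<noteq> \<rho> (Suc n)" "\<rho> 0 \<noteq> \<rho> (Suc (Suc n))"
    by (simp_all add: inj)
  show "\<rho> 0 \<in> V"
    using adj_in_V(1)[OF ray_adj[OF assms, of 0]] .
  show "adj (\<rho> (Suc n)) (\<rho> (Suc (Suc n)))"
    using ray_adj[OF assms] .
qed

lemma tail_subset_other_edges:
  assumes "ray \<rho>" "\<And>e. e \<in> F \<Longrightarrow> \<rho> 0 \<in> e"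
  shows "body (\<lambda>n. \<rho> (Suc n)) \<subseteq> \<Union>(E - F)"
  using ray_edge_in_E[OF assms(1)] tail_avoids_start[OF assms(1)] assms(2)
  unfolding body_def by blast

lemma first_edge_Int_other_edges:
  assumes "ray \<rho>" "edg (\<rho> 0) (\<rho> (Suc 0)) \<in> F"
  shows "edg (\<rho> 0) (\<rho> (Suc 0)) \<inter> \<Union>(E - F) \<subseteq> {\<rho> 0, \<rho> (Suc 0)}"
proof
  have a: "adj (\<rho> 0) (\<rho> (Suc 0))"
    using ray_adj[OF assms(1)] .
  fix x assume "x \<in> edg (\<rho> 0) (\<rho> (Suc 0)) \<inter> \<Union>(E - F)"
  then obtain e where "e \<in> E" "e \<notin> F" "x \<in> e" "x \<in> edg (\<rho> 0) (\<rho> (Suc 0))"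
    by blast
  moreover have "e \<noteq> edg (\<rho> 0) (\<rho> (Suc 0))"
    using \<open>e \<notin> F\<close> assms(2) by blast
  ultimately have "x \<in> V"
    using edges_meet_in_vertices[OF _ edg_props(1)[OF a], of e] by blast
  then show "x \<in> {\<rho> 0, \<rho> (Suc 0)}"
    using edg_props(4)[OF a] \<open>x \<in> edg (\<rho> 0) (\<rho> (Suc 0))\<close> by blast
qed

lemma tail_start_in_tail: "ray \<rho> \<Longrightarrow> \<rho> (Suc 0) \<in> body (\<lambda>n. \<rho> (Suc n))"
  using ray_vertex_in_body[OF ray_tail, of \<rho> 0] by simp

lemma complementary_component_open:
  assumes "e \<in> F" "F \<subseteq> E"
  shows "open (connected_component_set (- \<Union>(E - F)) x)"
  using closed_Union_edges[of "E - F"] by (intro open_connected_component) auto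

lemma edge_interior_disjoint:
  assumes "e \<in> F" "F \<subseteq> E"
  shows "(e - V) \<inter> \<Union>(E - F) = {}"
  using assms edges_meet_in_vertices[of e] by blast

text \<open>Without the open edge, the geodesic falls into two unbounded connected pieces, so
  \<open>component_on_side\<close> applies with \<open>F\<close> the single edge \<open>e\<close>
  and \<open>FA\<close> the edges of the geodesic. Each side of the geodesic then contributes one
  component along \<open>e\<close>. The closures are so far only known to meet inside the
  geodesic.\<close>

lemma edge_two_sides:
  assumes "forked \<rho> \<sigma>"
  defines "e \<equiv> edg (\<rho> 0) (\<rho> (Suc 0))"
  obtains R1 R2 where "R1 \<in> components (- \<Union>E)" "R2 \<in> components (- \<Union>E)" "R1 \<noteq> R2"
    "e \<subseteq> closure R1" "e \<subseteq> closure R2" "closure R1 \<inter> closure R2 \<subseteq> body \<rho> \<union> body \<sigma>"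
    "\<And>R. R \<in> components (- \<Union>E) \<Longrightarrow> closure R \<inter> (e - V) \<noteq> {} \<Longrightarrow> R = R1 \<or> R = R2"
proof -
  have rays: "ray \<rho>" "ray \<sigma>" "\<rho> 0 = \<sigma> 0" "\<rho> (Suc 0) \<noteq> \<sigma> (Suc 0)"
    using assms by (auto simp: forked_def)
  define L where "L = body \<rho> \<union> body \<sigma>"
  obtain S T where ST: "open S" "open T" "connected S" "connected T" "S \<inter> T = {}"
    "S \<union> T = - L" "frontier S = L" "frontier T = L"
    using line_separates[OF assms(1)] unfolding L_def by blast
  have eE: "e \<in> E" "\<rho> 0 \<in> e"
    unfolding e_def using edg_props[OF ray_adj[OF rays(1)]] by blast+
  have eL: "e \<subseteq> L"
    unfolding L_def e_def using body_eq[of \<rho>] by blast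
  define FA where "FA = ray_edges \<rho> \<union> ray_edges \<sigma>"
  have FA: "{e} \<subseteq> FA" "FA \<subseteq> E" "\<Union>FA = L"
    unfolding FA_def e_def L_def
    using first_edge_in_ray_edges[of \<rho>] ray_edges_subset[OF rays(1)] ray_edges_subset[OF rays(2)]
      Union_ray_edges[of \<rho>] Union_ray_edges[of \<sigma>] by blast+
  define \<C> where "\<C> = {body (\<lambda>n. \<rho> (Suc n)), body \<sigma>}"
  have "body \<sigma> \<subseteq> \<Union>(E - {e})"
  proof -
    have "edg (\<sigma> n) (\<sigma> (Suc n)) \<noteq> e" for n
    proof
      assume eq: "edg (\<sigma> n) (\<sigma> (Suc n)) = e"
      then have "\<rho> (Suc 0) \<in> {\<sigma> n, \<sigma> (Suc n)}"
        using edg_props(4)[OF ray_adj[OF rays(1), of 0]] edg_props(4)[OF ray_adj[OF rays(2), of n]]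
        unfolding e_def by auto
      then show False
        using forked_disjoint(1)[OF assms(1), of "Suc 0"] by blast
    qed
    then show ?thesis
      using ray_edge_in_E[OF rays(2)] unfolding body_def by blast
  qed
  moreover have "body (\<lambda>n. \<rho> (Suc n)) \<subseteq> \<Union>(E - {e})"
    using tail_subset_other_edges[OF rays(1)] eE(2) by blast
  moreover have "e \<inter> \<Union>(E - {e}) \<subseteq> {\<rho> 0, \<rho> (Suc 0)}"
    using first_edge_Int_other_edges[OF rays(1), of "{e}"] unfolding e_def by blast
  moreover have "\<rho> 0 \<in> body \<sigma>"
    using ray_vertex_in_body[OF rays(2), of 0] rays(3) by simp
  moreover have "L = e \<union> body (\<lambda>n. \<rho> (Suc n)) \<union> body \<sigma>"
    unfolding L_def e_def using body_eq[of \<rho>] by blast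
  moreover have "(X \<union> A \<union> B) \<inter> M = A \<union> B"
    if "B \<subseteq> M" "A \<subseteq> M" "X \<inter> M \<subseteq> {a, b}" "a \<in> B" "b \<in> A" for X A B M :: "complex set" and a b
    using that by blast
  ultimately have meet: "\<Union>FA \<inter> \<Union>(E - {e}) = \<Union>\<C>"
    unfolding FA(3) \<C>_def using tail_start_in_tail[OF rays(1)] by simp
  have \<C>: "connected C \<and> \<not> bounded C" if "C \<in> \<C>" for C
    using that connected_body unbounded_body rays(2) ray_tail[OF rays(1)] unfolding \<C>_def by blast
  obtain x0 where x0: "x0 \<in> e - V"
    using edge_interior_nonempty[OF eE(1)] by blast
  define G where "G = connected_component_set (- \<Union>(E - {e})) x0"
  have G: "open G" "connected G" "G \<inter> \<Union>(E - {e}) = {}"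
    unfolding G_def using complementary_component_open[of e "{e}"] eE(1)
      connected_component_subset[of "- \<Union>(E - {e})" x0] by auto
  have eG: "e - V \<subseteq> G"
    unfolding G_def
    using x0 connected_edge_interior[OF eE(1)] edge_interior_disjoint[of e "{e}"] eE(1)
    by (intro connected_component_maximal) auto
  have D: "e - V \<subseteq> closure S \<inter> G" "e - V \<subseteq> closure T \<inter> G" "e - V \<noteq> {}"
    using eG eL ST(7,8) x0 unfolding frontier_def by blast+
  have off: "S \<subseteq> - \<Union>FA" "T \<subseteq> - \<Union>FA"
    using FA(3) ST(6) by blast+
  obtain R1 where R1: "R1 \<in> components (- \<Union>E)" "S \<inter> G \<subseteq> R1" "S \<inter> G \<noteq> {}" "e - V \<subseteq> closure R1"
    by (rule component_on_side[OF FA(1,2) meet \<C> G ST(3) off(1) D(1,3)])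
  obtain R2 where R2: "R2 \<in> components (- \<Union>E)" "T \<inter> G \<subseteq> R2" "T \<inter> G \<noteq> {}" "e - V \<subseteq> closure R2"
    by (rule component_on_side[OF FA(1,2) meet \<C> G ST(4) off(2) D(2,3)])
  note R = R1 R2
  have cover: "- \<Union>E \<subseteq> S \<union> T"
    using ST(6) FA by blast
  have "R1 \<inter> S \<noteq> {}" "R2 \<inter> T \<noteq> {}"
    using R by blast+
  then have sub: "R1 \<subseteq> S" "R2 \<subseteq> T"
    using component_subset_side[OF R(1) cover ST(1,2,5)]
      component_subset_side[of R2 T S] R(5) cover ST by blast+
  have "closure S \<inter> closure T \<subseteq> L"
  proof -
    have "closure S \<inter> T = {}"
      using open_Int_closure_eq_empty[OF ST(2), of S] ST(5) by blast
    moreover have "closure T \<subseteq> T \<union> L"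
      using ST(2,8) by (auto simp: frontier_def interior_open)
    ultimately show ?thesis
      by blast
  qed
  then have "closure R1 \<inter> closure R2 \<subseteq> L"
    using closure_mono[OF sub(1)] closure_mono[OF sub(2)] by blast
  moreover have "R1 \<noteq> R2"
    using sub ST(5) R in_components_nonempty by blast
  moreover have "e \<subseteq> closure R1" "e \<subseteq> closure R2"
    using edge_subset_closure_interior[OF eE(1)] R(4,8) closure_minimal[OF _ closed_closure] by (meson order_trans)+
  \<comment> \<open>\<open>G\<close> is an open set around the open edge, and its points off the
    tree lie in \<open>S\<close> or \<open>T\<close>, hence in \<open>R1\<close> or
    \<open>R2\<close>. A component touching the open edge meets \<open>G\<close> and so overlaps one
    of these two.\<close>
  moreover have "Q = R1 \<or> Q = R2" if Q: "Q \<in> components (- \<Union>E)" "closure Q \<inter> (e - V) \<noteq> {}" for Q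
  proof -
    have "G \<inter> closure Q \<noteq> {}"
      using Q(2) eG by blast
    then obtain y where y: "y \<in> G" "y \<in> Q"
      using open_Int_closure_eq_empty[OF G(1), of Q] by blast
    then have "y \<in> S \<union> T"
      using in_components_subset[OF Q(1)] cover by blast
    then have "y \<in> R1 \<or> y \<in> R2"
      using y R by blast
    then show ?thesis
      using components_nonoverlap[OF Q(1) R(1)] components_nonoverlap[OF Q(1) R(5)] y(2) by blast
  qed
  ultimately show ?thesis
    using that[of R1 R2] R unfolding L_def by blast
qed

text \<open>Degree 3 leaves two ways to continue beyond each end of \<open>e\<close>. Using one of
  them at each end for one geodesic and the other for a second gives two geodesics that meet only in
  \<open>e\<close>, and the intersection of the closures lies in both.\<close>

lemma edge_regions_meet:
  assumes "e \<in> E"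
  obtains R1 R2 where "R1 \<in> components (- \<Union>E)" "R2 \<in> components (- \<Union>E)" "R1 \<noteq> R2"
    "closure R1 \<inter> closure R2 = e"
    "\<And>R. R \<in> components (- \<Union>E) \<Longrightarrow> closure R \<inter> (e - V) \<noteq> {} \<longleftrightarrow> R = R1 \<or> R = R2"
proof -
  obtain v where v: "v \<in> e" "v \<in> V"
    using edge_ends[OF assms] by blast
  obtain w where w: "adj v w" "e = edg v w"
    using edge_eq_edg[OF assms v] .
  obtain \<rho> where \<rho>: "ray \<rho>" "\<rho> 0 = v" "\<rho> (Suc 0) = w"
    using ray_exists[OF w(1)] .
  obtain a where a: "adj v a" "a \<noteq> w"
    using another_neighbour[OF v(2), of w w] by blast
  obtain b where b: "adj v b" "b \<noteq> w" "b \<noteq> a"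
    using another_neighbour[OF v(2), of w a] by blast
  obtain c where c: "adj w c" "c \<noteq> v" "c \<noteq> \<rho> (Suc (Suc 0))"
    using another_neighbour[OF adj_in_V(2)[OF w(1)], of v "\<rho> (Suc (Suc 0))"] by blast
  obtain \<sigma> where \<sigma>: "ray \<sigma>" "\<sigma> 0 = v" "\<sigma> (Suc 0) = a"
    using ray_exists[OF a(1)] .
  obtain \<tau> where \<tau>: "ray \<tau>" "\<tau> 0 = v" "\<tau> (Suc 0) = b"
    using ray_exists[OF b(1)] .
  obtain \<kappa> where \<kappa>: "ray \<kappa>" "\<kappa> 0 = w" "\<kappa> (Suc 0) = c"
    using ray_exists[OF c(1)] .
  \<comment> \<open>The vertex \<open>v\<close> is prepended to the ray that leaves \<open>w\<close>
    by its other branch.\<close>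
  define \<rho>' where "\<rho>' = case_nat v \<kappa>"
  have \<rho>'_simps: "\<rho>' 0 = v" "\<rho>' (Suc n) = \<kappa> n" for n
    by (simp_all add: \<rho>'_def)
  have \<rho>'_ray: "ray \<rho>'"
    unfolding ray_def
  proof
    fix n
    show "adj (\<rho>' n) (\<rho>' (Suc n)) \<and> \<rho>' (Suc (Suc n)) \<noteq> \<rho>' n"
      using \<kappa> w(1) c(2) by (cases n) (simp_all add: \<rho>'_simps ray_def)
  qed
  have forks: "forked \<rho> \<sigma>" "forked \<rho>' \<tau>" "forked \<rho> \<tau>" "forked \<rho>' \<sigma>" "forked \<sigma> \<tau>"
      "forked (\<lambda>n. \<rho> (Suc n)) \<kappa>"
    using \<rho> \<sigma> \<tau> \<kappa> a b c \<rho>'_ray ray_tail[OF \<rho>(1)] by (simp_all add: forked_def \<rho>'_simps)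
  have bodies: "body \<rho> = e \<union> body (\<lambda>n. \<rho> (Suc n))" "body \<rho>' = e \<union> body \<kappa>"
    using body_eq[of \<rho>] body_eq[of \<rho>'] \<rho> \<kappa> w(2) by (simp_all add: \<rho>'_simps)
  have "body \<rho> \<inter> body \<tau> \<subseteq> {v}" "body \<rho>' \<inter> body \<sigma> \<subseteq> {v}" "body \<sigma> \<inter> body \<tau> \<subseteq> {v}"
    "body (\<lambda>n. \<rho> (Suc n)) \<inter> body \<kappa> \<subseteq> {w}"
    using forks(3-6)[THEN forked_bodies_meet] \<rho>(2,3) \<sigma>(2) \<rho>'_simps(1) by simp_all
  moreover have "w \<in> e"
    using edg_props(3)[OF w(1)] w(2) by simp
  moreover have "(X \<union> A \<union> B) \<inter> (X \<union> C \<union> D) \<subseteq> X"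
    if "(X \<union> A) \<inter> D \<subseteq> {v}" "(X \<union> C) \<inter> B \<subseteq> {v}" "B \<inter> D \<subseteq> {v}" "A \<inter> C \<subseteq> {w}" "w \<in> X" "v \<in> X"
    for X A B C D :: "complex set"
    using that by auto
  ultimately have lines: "(body \<rho> \<union> body \<sigma>) \<inter> (body \<rho>' \<union> body \<tau>) \<subseteq> e"
    unfolding bodies using v(1) by presburger
  obtain R1 R2 where R: "R1 \<in> components (- \<Union>E)" "R2 \<in> components (- \<Union>E)" "R1 \<noteq> R2"
    "e \<subseteq> closure R1" "e \<subseteq> closure R2" "closure R1 \<inter> closure R2 \<subseteq> body \<rho> \<union> body \<sigma>"
    "\<And>R. R \<in> components (- \<Union>E) \<Longrightarrow> closure R \<inter> (e - V) \<noteq> {} \<Longrightarrow> R = R1 \<or> R = R2"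
    using edge_two_sides[OF forks(1)] unfolding \<rho> w(2)[symmetric] by metis
  obtain Q1 Q2 where Q: "Q1 \<in> components (- \<Union>E)" "Q2 \<in> components (- \<Union>E)" "Q1 \<noteq> Q2"
    "e \<subseteq> closure Q1" "e \<subseteq> closure Q2" "closure Q1 \<inter> closure Q2 \<subseteq> body \<rho>' \<union> body \<tau>"
    "\<And>R. R \<in> components (- \<Union>E) \<Longrightarrow> closure R \<inter> (e - V) \<noteq> {} \<Longrightarrow> R = Q1 \<or> R = Q2"
    using edge_two_sides[OF forks(2)] unfolding \<rho>'_simps \<kappa> w(2)[symmetric] by metis
  have ne: "e - V \<noteq> {}"
    using edge_interior_nonempty[OF assms] .
  have hit: "closure R1 \<inter> (e - V) \<noteq> {}" "closure R2 \<inter> (e - V) \<noteq> {}"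
    using R(4,5) ne by blast+
  \<comment> \<open>Both pairs consist of the components touching the open edge, so the two
    geodesics speak about the same components.\<close>
  then have "R1 = Q1 \<and> R2 = Q2 \<or> R1 = Q2 \<and> R2 = Q1"
    using Q(7)[OF R(1)] Q(7)[OF R(2)] R(3) by blast
  then have "closure R1 \<inter> closure R2 \<subseteq> body \<rho>' \<union> body \<tau>"
    using Q(6) by blast
  then have "closure R1 \<inter> closure R2 = e"
    using R(4-6) lines by blast
  then show ?thesis
    using that[of R1 R2] R(1-3,7) hit by blast
qed

section \<open>The three regions around a vertex\<close>

lemma star_neighbourhood:
  fixes v
  defines "F \<equiv> {e \<in> E. v \<in> e}"
  obtains G where "open G" "connected G" "G \<inter> \<Union>(E - F) = {}" "v \<in> G" "\<forall>e\<in>F. e - V \<subseteq> G"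
proof -
  have F: "F \<subseteq> E"
    by (auto simp: F_def)
  have vM: "v \<notin> \<Union>(E - F)"
    unfolding F_def by blast
  define G where "G = connected_component_set (- \<Union>(E - F)) v"
  have "closed (\<Union>(E - F))"
    by (rule closed_Union_edges) blast
  then have "open G"
    unfolding G_def by (intro open_connected_component) auto
  moreover have "connected G" "G \<inter> \<Union>(E - F) = {}"
    unfolding G_def using connected_component_subset[of "- \<Union>(E - F)" v] by auto
  moreover have "v \<in> G"
    unfolding G_def using vM by (simp add: connected_component_refl_eq)
  moreover have "e - V \<subseteq> G" if "e \<in> F" for e
  proof -
    have "e \<in> E" "v \<in> e"
      using that by (auto simp: F_def)
    have "insert v (e - V) \<subseteq> closure (e - V)"
      using edge_subset_closure_interior[OF \<open>e \<in> E\<close>] \<open>v \<in> e\<close> by blast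
    then have "connected (insert v (e - V))"
      by (rule connected_intermediate_closure[OF connected_edge_interior[OF \<open>e \<in> E\<close>] subset_insertI])
    then have "insert v (e - V) \<subseteq> G"
      unfolding G_def using edge_interior_disjoint[OF that F] vM
      by (intro connected_component_maximal) blast+
    then show ?thesis
      by blast
  qed
  ultimately show ?thesis
    using that[of G] by simp
qed

text \<open>Here the star of the vertex is cut out of the tripod formed by the three rays, which
  leaves three unbounded tails. The side of the line through the first two rays that does not
  contain the third avoids the whole tripod, so it contributes a single component along both edges.
  The third edge runs on the other side and is not touched in its open part.\<close>

lemma corner_region:
  assumes forks: "forked \<rho> \<sigma>" "forked \<rho> \<tau>" "forked \<sigma> \<tau>"
    and star: "{e \<in> E. \<rho> 0 \<in> e} =
      {edg (\<rho> 0) (\<rho> (Suc 0)), edg (\<sigma> 0) (\<sigma> (Suc 0)), edg (\<tau> 0) (\<tau> (Suc 0))}"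
  shows "\<exists>R \<in> components (- \<Union>E). edg (\<rho> 0) (\<rho> (Suc 0)) \<subseteq> closure R \<and>
    edg (\<sigma> 0) (\<sigma> (Suc 0)) \<subseteq> closure R \<and> closure R \<inter> (edg (\<tau> 0) (\<tau> (Suc 0)) - V) = {}"
proof -
  define v where "v = \<rho> 0"
  have rays: "ray \<rho>" "ray \<sigma>" "ray \<tau>" "\<rho> 0 = v" "\<sigma> 0 = v" "\<tau> 0 = v"
    using forks by (auto simp: forked_def v_def)
  define e1 where "e1 = edg (\<rho> 0) (\<rho> (Suc 0))"
  define e2 where "e2 = edg (\<sigma> 0) (\<sigma> (Suc 0))"
  define e3 where "e3 = edg (\<tau> 0) (\<tau> (Suc 0))"
  define F where "F = {e \<in> E. v \<in> e}"
  have F: "F = {e1, e2, e3}" "F \<subseteq> E"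
    using star unfolding F_def e1_def e2_def e3_def v_def by auto
  have eE: "e1 \<in> E" "e2 \<in> E" "e3 \<in> E"
    using F by blast+
  have vV: "v \<in> V"
    using adj_in_V(1)[OF ray_adj[OF rays(1), of 0]] rays(4) by simp
  have vM: "v \<notin> \<Union>(E - F)"
    unfolding F_def by blast
  define FA where "FA = ray_edges \<rho> \<union> ray_edges \<sigma> \<union> ray_edges \<tau>"
  have FA: "F \<subseteq> FA" "FA \<subseteq> E" "\<Union>FA = body \<rho> \<union> body \<sigma> \<union> body \<tau>"
    unfolding FA_def F e1_def e2_def e3_def Union_Un_distrib Union_ray_edges
    using first_edge_in_ray_edges[of \<rho>] first_edge_in_ray_edges[of \<sigma>] first_edge_in_ray_edges[of \<tau>]
      ray_edges_subset[OF rays(1)] ray_edges_subset[OF rays(2)] ray_edges_subset[OF rays(3)]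
    by auto
  define tails where "tails = {body (\<lambda>n. \<rho> (Suc n)), body (\<lambda>n. \<sigma> (Suc n)), body (\<lambda>n. \<tau> (Suc n))}"
  have vF: "v \<in> e" if "e \<in> F" for e
    using that by (simp add: F_def)
  have "body r \<inter> \<Union>(E - F) = body (\<lambda>n. r (Suc n))"
    if r: "ray r" "r 0 = v" "edg (r 0) (r (Suc 0)) \<in> F" for r
  proof -
    have "(X \<union> A) \<inter> M = A" if "A \<subseteq> M" "X \<inter> M \<subseteq> {v, b}" "b \<in> A" "v \<notin> M" for X A M :: "complex set" and b
      using that by blast
    then show ?thesis
      using tail_subset_other_edges[OF r(1), of F] first_edge_Int_other_edges[OF r(1,3)]
        tail_start_in_tail[OF r(1)] vM vF body_eq[of r] r(2) by metis
  qed
  then have "body \<rho> \<inter> \<Union>(E - F) = body (\<lambda>n. \<rho> (Suc n))"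
    "body \<sigma> \<inter> \<Union>(E - F) = body (\<lambda>n. \<sigma> (Suc n))" "body \<tau> \<inter> \<Union>(E - F) = body (\<lambda>n. \<tau> (Suc n))"
    using rays F unfolding e1_def e2_def e3_def by auto
  then have meet: "\<Union>FA \<inter> \<Union>(E - F) = \<Union>tails"
    unfolding FA(3) tails_def by (simp add: Int_Un_distrib2 Un_assoc)
  have tails: "connected C \<and> \<not> bounded C" if "C \<in> tails" for C
    using that connected_body unbounded_body rays(1-3)[THEN ray_tail] unfolding tails_def by blast
  obtain G where G: "open G" "connected G" "G \<inter> \<Union>(E - F) = {}" and "v \<in> G"
    and eG: "\<forall>e\<in>F. e - V \<subseteq> G"
    by (rule star_neighbourhood[of v, folded F_def])
  define L where "L = body \<rho> \<union> body \<sigma>"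
  obtain S T where ST: "open S" "open T" "connected S" "connected T" "S \<inter> T = {}"
    "S \<union> T = - L" "frontier S = L" "frontier T = L" and third: "body \<tau> - {v} \<subseteq> T"
  proof -
    obtain S T where ST: "open S" "open T" "connected S" "connected T" "S \<inter> T = {}"
      "S \<union> T = - L" "frontier S = L" "frontier T = L"
      using line_separates[OF forks(1)] unfolding L_def by blast
    have "e3 - V \<subseteq> e3 - {v}" "e3 - {v} \<subseteq> closure (e3 - V)"
      using edge_subset_closure_interior[OF eE(3)] vV by blast+
    then have "connected (e3 - {v})"
      by (rule connected_intermediate_closure[OF connected_edge_interior[OF eE(3)]])
    moreover have "\<tau> (Suc 0) \<in> (e3 - {v}) \<inter> body (\<lambda>n. \<tau> (Suc n))"
      using tail_start_in_tail[OF rays(3)] edg_props(3)[OF ray_adj[OF rays(3), of 0]]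
        adj_neq[OF ray_adj[OF rays(3), of 0]] rays(6) unfolding e3_def by auto
    ultimately have "connected ((e3 - {v}) \<union> body (\<lambda>n. \<tau> (Suc n)))"
      using connected_body[OF ray_tail[OF rays(3)]] by (intro connected_Un) auto
    moreover have "v \<notin> body (\<lambda>n. \<tau> (Suc n))"
      using tail_avoids_start[OF rays(3)] rays(6) by (simp add: body_def)
    then have "body \<tau> - {v} = (e3 - {v}) \<union> body (\<lambda>n. \<tau> (Suc n))"
      using body_eq[of \<tau>] unfolding e3_def by blast
    \<comment> \<open>The third ray without its starting point is connected and off the line, so it
      stays on one side; that side is named \<open>T\<close>.\<close>
    ultimately have con: "connected (body \<tau> - {v})"
      by simp
    have "body \<tau> - {v} \<subseteq> - L"
      using forked_bodies_meet[OF forks(2)] forked_bodies_meet[OF forks(3)] rays unfolding L_def by auto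
    then have "body \<tau> - {v} \<subseteq> S \<or> body \<tau> - {v} \<subseteq> T"
      using connectedD[OF con ST(1,2)] ST(5,6) by blast
    then show thesis
      using that[of S T] that[of T S] ST by (metis Int_commute Un_commute)
  qed
  have vL: "v \<in> L"
    using ray_vertex_in_body[OF rays(1), of 0] rays(4) unfolding L_def by simp
  have offS: "S \<subseteq> - \<Union>FA"
    unfolding FA(3) L_def[symmetric] using ST(5,6) third vL by blast
  have "e1 \<subseteq> L" "e2 \<subseteq> L"
    unfolding L_def e1_def e2_def using body_eq[of \<rho>] body_eq[of \<sigma>] by blast+
  moreover have "L \<subseteq> closure S"
    using ST(7) by (auto simp: frontier_def)
  moreover have "e1 - V \<subseteq> G" "e2 - V \<subseteq> G"
    using eG F(1) by simp_all
  ultimately have D: "(e1 - V) \<union> (e2 - V) \<subseteq> closure S \<inter> G"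
    by blast
  have D0: "(e1 - V) \<union> (e2 - V) \<noteq> {}"
    using edge_interior_nonempty[OF eE(1)] by blast
  obtain R where R: "R \<in> components (- \<Union>E)" "S \<inter> G \<subseteq> R" "S \<inter> G \<noteq> {}" "(e1 - V) \<union> (e2 - V) \<subseteq> closure R"
    by (rule component_on_side[OF FA(1,2) meet tails G ST(3) offS D D0])
  have "- \<Union>E \<subseteq> S \<union> T"
    using ST(6) FA unfolding L_def by blast
  then have "R \<subseteq> S"
    using component_subset_side[OF R(1) _ ST(1,2,5)] R(2,3) by blast
  moreover have "closure S = S \<union> L"
    using ST(1,7) closure_subset[of S] unfolding frontier_def by (auto simp: interior_open)
  ultimately have "closure R \<subseteq> S \<union> L"
    using closure_mono[of R S] by simp
  moreover have "e3 - V \<subseteq> T"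
    using third body_eq[of \<tau>] vV unfolding e3_def by blast
  ultimately have "closure R \<inter> (e3 - V) = {}"
    using ST(5,6) by blast
  moreover have "e1 \<subseteq> closure R" "e2 \<subseteq> closure R"
    using edge_subset_closure_interior[OF eE(1)] edge_subset_closure_interior[OF eE(2)] R(4)
      closure_minimal[of "e1 - V" "closure R"] closure_minimal[of "e2 - V" "closure R"] by auto
  ultimately show ?thesis
    using R(1) unfolding e1_def e2_def e3_def by blast
qed

lemma three_neighbours_including:
  assumes "adj v w"
  obtains w2 w3 where "adj v w2" "adj v w3" "w \<noteq> w2" "w \<noteq> w3" "w2 \<noteq> w3"
    "{e \<in> E. v \<in> e} = {edg v w, edg v w2, edg v w3}"
proof -
  obtain a b c where abc: "adj v a" "adj v b" "adj v c" "a \<noteq> b" "a \<noteq> c" "b \<noteq> c"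
    "{e \<in> E. v \<in> e} = {edg v a, edg v b, edg v c}"
    using three_neighbours[OF adj_in_V(1)[OF assms]] .
  have "w = x" if "adj v x" "edg v w = edg v x" for x
    using edg_props(4)[OF assms] edg_props(4)[OF that(1)] that(2) by (auto simp: doubleton_eq_iff)
  moreover have "edg v w \<in> {edg v a, edg v b, edg v c}"
    using abc(7) edg_props(1,2)[OF assms] by blast
  ultimately consider "w = a" | "w = b" | "w = c"
    using abc(1-3) by blast
  then show ?thesis
  proof cases
    case 1
    then show ?thesis
      using that[of b c] abc by simp
  next
    case 2
    then show ?thesis
      using that[of a c] abc by (simp add: insert_commute)
  next
    case 3
    then show ?thesis
      using that[of a b] abc by (simp add: insert_commute)
  qed
qed

lemma open_region_component: "R \<in> components (- \<Union>E) \<Longrightarrow> open R"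
  using closed_Union_edges[of E] open_components[of "- \<Union>E" R] by auto

lemma region_component_frontier: "R \<in> components (- \<Union>E) \<Longrightarrow> frontier R \<subseteq> \<Union>E"
  using closed_Union_edges[of E] frontier_of_components_closed_complement[of "\<Union>E" R] by auto

text \<open>Consequently the neighbourhood of \<open>star_neighbourhood\<close>, which avoids all
  edges not at \<open>v\<close>, does not contain the far ends of the edges at
  \<open>v\<close>.\<close>

lemma other_end_on_other_edge:
  assumes "e \<in> E" "v \<in> e" "v \<in> V" "w \<in> e" "w \<in> V" "w \<noteq> v"
  shows "w \<in> \<Union>(E - {e \<in> E. v \<in> e})"
proof -
  obtain x where x: "adj w x" "x \<noteq> v"
    using another_neighbour[OF assms(5), of v v] by blast
  then have "v \<notin> edg w x"
    using vertex_notin_edg[OF x(1) assms(3)] assms(6) by blast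
  then show ?thesis
    using edg_props(1,2)[OF x(1)] by blast
qed

text \<open>A component touching \<open>v\<close> but none of its edges would contain a punctured
  neighbourhood of \<open>v\<close>.\<close>

lemma region_at_vertex_has_edge:
  assumes "v \<in> V" "R \<in> components (- \<Union>E)" "v \<in> closure R"
  shows "\<exists>e\<in>E. v \<in> e \<and> closure R \<inter> (e - V) \<noteq> {}"
proof (rule ccontr)
  assume none: "\<not> ?thesis"
  define F where "F = {e \<in> E. v \<in> e}"
  obtain G where G: "open G" "connected G" "G \<inter> \<Union>(E - F) = {}" "v \<in> G" "\<forall>e\<in>F. e - V \<subseteq> G"
    by (rule star_neighbourhood[of v, folded F_def])
  have "card F = 3"
    using degree_3[OF assms(1)] by (simp add: F_def)
  then have "F \<noteq> {}"
    by auto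
  then obtain e where e: "e \<in> F" "e \<in> E" "v \<in> e"
    by (auto simp: F_def)
  have conn: "connected (G - {v})"
    using G(1,2) by (intro connected_open_delete) auto
  have "frontier R \<inter> (G - {v}) = {}"
  proof (rule ccontr)
    assume "frontier R \<inter> (G - {v}) \<noteq> {}"
    then obtain x where x: "x \<in> frontier R" "x \<in> G" "x \<noteq> v"
      by blast
    then obtain e' where e': "e' \<in> E" "x \<in> e'"
      using region_component_frontier[OF assms(2)] by blast
    then have "v \<in> e'"
      using G(3) x(2) unfolding F_def by blast
    moreover have "x \<notin> V"
      using other_end_on_other_edge[OF e'(1) \<open>v \<in> e'\<close> assms(1) e'(2)] x(2,3) G(3) unfolding F_def by blast
    moreover have "x \<in> closure R"
      using x(1) by (simp add: frontier_def)
    ultimately show False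
      using none e' by blast
  qed
  moreover have "(G - {v}) \<inter> R \<noteq> {}"
  proof -
    have "G \<inter> R \<noteq> {}"
      using open_Int_closure_eq_empty[OF G(1), of R] G(4) assms(3) by blast
    moreover have "v \<notin> R"
      using in_components_subset[OF assms(2)] e(2,3) by blast
    ultimately show ?thesis
      by blast
  qed
  ultimately have sub: "G - {v} \<subseteq> R"
    using connected_Int_frontier[OF conn, of R] by blast
  obtain x where x: "x \<in> e - V"
    using edge_interior_nonempty[OF e(2)] by blast
  then have "x \<in> R"
    using sub G(5) e(1) assms(1) by blast
  then show False
    using in_components_subset[OF assms(2)] x e(2) by blast
qed

text \<open>Each pair of edges at \<open>v\<close> spans a corner, and the three corners differ
  because each leaves a different open edge untouched. A component at \<open>v\<close> touches an
  open edge there, and the two corners along that edge already exhaust the components touching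
  it.\<close>

lemma vertex_components:
  assumes "e \<in> E" "v \<in> e" "v \<in> V"
  obtains X Y Z where "X \<in> components (- \<Union>E)" "Y \<in> components (- \<Union>E)" "Z \<in> components (- \<Union>E)"
    "X \<noteq> Y" "X \<noteq> Z" "Y \<noteq> Z" "closure X \<inter> closure Y = e"
    "\<And>R. R \<in> components (- \<Union>E) \<Longrightarrow> closure R \<inter> (e - V) \<noteq> {} \<longleftrightarrow> R \<in> {X, Y}"
    "\<And>R. R \<in> components (- \<Union>E) \<Longrightarrow> v \<in> closure R \<longleftrightarrow> R \<in> {X, Y, Z}"
    "\<And>R. R \<in> {X, Y, Z} \<Longrightarrow> \<exists>e'\<in>E. v \<in> e' \<and> closure R \<inter> (e' - V) = {}"
proof -
  obtain w1 where w1: "adj v w1" "e = edg v w1"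
    using edge_eq_edg[OF assms] .
  obtain w2 w3 where w: "adj v w2" "adj v w3" "w1 \<noteq> w2" "w1 \<noteq> w3" "w2 \<noteq> w3"
    "{e \<in> E. v \<in> e} = {edg v w1, edg v w2, edg v w3}"
    using three_neighbours_including[OF w1(1)] .
  define e2 where "e2 = edg v w2"
  define e3 where "e3 = edg v w3"
  obtain \<rho> where \<rho>: "ray \<rho>" "\<rho> 0 = v" "\<rho> (Suc 0) = w1"
    using ray_exists[OF w1(1)] .
  obtain \<sigma> where \<sigma>: "ray \<sigma>" "\<sigma> 0 = v" "\<sigma> (Suc 0) = w2"
    using ray_exists[OF w(1)] .
  obtain \<tau> where \<tau>: "ray \<tau>" "\<tau> 0 = v" "\<tau> (Suc 0) = w3"
    using ray_exists[OF w(2)] .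
  have forks: "forked \<rho> \<sigma>" "forked \<rho> \<tau>" "forked \<sigma> \<tau>"
    using \<rho> \<sigma> \<tau> w by (simp_all add: forked_def)
  have star: "{e \<in> E. v \<in> e} = {e, e2, e3}"
    using w(6) unfolding w1(2) e2_def e3_def .
  have eE: "e2 \<in> E" "e3 \<in> E" "v \<in> e2" "v \<in> e3"
    using star by blast+
  have edges: "edg (\<rho> 0) (\<rho> (Suc 0)) = e" "edg (\<sigma> 0) (\<sigma> (Suc 0)) = e2" "edg (\<tau> 0) (\<tau> (Suc 0)) = e3"
    using \<rho> \<sigma> \<tau> by (simp_all add: w1(2) e2_def e3_def)
  have stars: "{e \<in> E. \<rho> 0 \<in> e} = {e, e2, e3}" "{e \<in> E. \<rho> 0 \<in> e} = {e, e3, e2}"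
    "{e \<in> E. \<sigma> 0 \<in> e} = {e2, e3, e}"
    using star by (simp_all add: \<rho>(2) \<sigma>(2) insert_commute)
  obtain X where X: "X \<in> components (- \<Union>E)" "e \<subseteq> closure X" "e2 \<subseteq> closure X" "closure X \<inter> (e3 - V) = {}"
    using corner_region[OF forks, unfolded edges, OF stars(1)] by (elim bexE conjE)
  obtain Y where Y: "Y \<in> components (- \<Union>E)" "e \<subseteq> closure Y" "e3 \<subseteq> closure Y" "closure Y \<inter> (e2 - V) = {}"
    using corner_region[OF forks(2,1) forked_sym[OF forks(3)], unfolded edges, OF stars(2)] by (elim bexE conjE)
  obtain Z where Z: "Z \<in> components (- \<Union>E)" "e2 \<subseteq> closure Z" "e3 \<subseteq> closure Z" "closure Z \<inter> (e - V) = {}"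
    using corner_region[OF forks(3) forked_sym[OF forks(1)] forked_sym[OF forks(2)], unfolded edges, OF stars(3)]
    by (elim bexE conjE)
  have ne: "e - V \<noteq> {}" "e2 - V \<noteq> {}" "e3 - V \<noteq> {}"
    using edge_interior_nonempty[OF assms(1)] edge_interior_nonempty[OF eE(1)] edge_interior_nonempty[OF eE(2)] .
  have diff: "X \<noteq> Y" "X \<noteq> Z" "Y \<noteq> Z"
    using X(2,4) Y(2,4) Z(2,4) X(3) Y(3) Z(3) ne by blast+
  \<comment> \<open>\<open>edge_regions_meet\<close> names no particular pair, but any two distinct
    components with \<open>d\<close> in their closures must be that pair.\<close>
  have two: "closure R \<inter> (d - V) \<noteq> {} \<longleftrightarrow> R \<in> {A, B}"
    if d: "d \<in> E" "A \<in> components (- \<Union>E)" "B \<in> components (- \<Union>E)" "A \<noteq> B" "d \<subseteq> closure A" "d \<subseteq> closure B"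
      "R \<in> components (- \<Union>E)" for d A B R
  proof -
    obtain P Q where PQ: "\<And>R. R \<in> components (- \<Union>E) \<Longrightarrow> closure R \<inter> (d - V) \<noteq> {} \<longleftrightarrow> R = P \<or> R = Q"
      using edge_regions_meet[OF d(1)] by metis
    have "d - V \<noteq> {}"
      using edge_interior_nonempty[OF d(1)] .
    then have "closure A \<inter> (d - V) \<noteq> {}" "closure B \<inter> (d - V) \<noteq> {}"
      using d(5,6) by blast+
    then have "A = P \<or> A = Q" "B = P \<or> B = Q"
      using PQ d(2,3) by blast+
    then show ?thesis
      using PQ[OF d(7)] d(4) by auto
  qed
  have vcl: "v \<in> closure R \<longleftrightarrow> R \<in> {X, Y, Z}" if R: "R \<in> components (- \<Union>E)" for R
  proof
    assume "v \<in> closure R"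
    then obtain d where "d \<in> {e, e2, e3}" "closure R \<inter> (d - V) \<noteq> {}"
      using region_at_vertex_has_edge[OF assms(3) R] unfolding star[symmetric] by blast
    then have "closure R \<inter> (e - V) \<noteq> {} \<or> closure R \<inter> (e2 - V) \<noteq> {} \<or> closure R \<inter> (e3 - V) \<noteq> {}"
      by (elim insertE emptyE) simp_all
    then have "R \<in> {X, Y} \<or> R \<in> {X, Z} \<or> R \<in> {Y, Z}"
      unfolding two[OF assms(1) X(1) Y(1) diff(1) X(2) Y(2) R]
        two[OF eE(1) X(1) Z(1) diff(2) X(3) Z(2) R] two[OF eE(2) Y(1) Z(1) diff(3) Y(3) Z(3) R] .
    then show "R \<in> {X, Y, Z}"
      by blast
  next
    assume "R \<in> {X, Y, Z}"
    then show "v \<in> closure R"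
      using X(2) Y(2) Z(2) assms(2) eE(3) by auto
  qed
  have meet: "closure X \<inter> closure Y = e"
  proof -
    obtain P Q where PQ: "closure P \<inter> closure Q = e"
      "\<And>R. R \<in> components (- \<Union>E) \<Longrightarrow> closure R \<inter> (e - V) \<noteq> {} \<longleftrightarrow> R = P \<or> R = Q"
      using edge_regions_meet[OF assms(1)] by metis
    have "closure X \<inter> (e - V) \<noteq> {}" "closure Y \<inter> (e - V) \<noteq> {}"
      using X(2) Y(2) ne(1) by blast+
    then have "X = P \<and> Y = Q \<or> X = Q \<and> Y = P"
      using PQ(2)[OF X(1)] PQ(2)[OF Y(1)] diff(1) by blast
    then show ?thesis
      using PQ(1) by blast
  qed
  have "\<exists>e'\<in>E. v \<in> e' \<and> closure R \<inter> (e' - V) = {}" if "R \<in> {X, Y, Z}" for R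
    using that X(4) Y(4) Z(4) eE assms(1,2) by auto
  then show ?thesis
    using that[OF X(1) Y(1) Z(1) diff meet two[OF assms(1) X(1) Y(1) diff(1) X(2) Y(2)] vcl] by blast
qed

text \<open>Components are open, so two of them with a common closure overlap. Counting components
  therefore counts regions.\<close>

lemma region_component_inj:
  assumes "R \<in> components (- \<Union>E)" "R' \<in> components (- \<Union>E)" "closure R = closure R'"
  shows "R = R'"
proof -
  have "R \<inter> closure R' \<noteq> {}"
    using assms closure_subset[of R] in_components_nonempty[OF assms(1)] by blast
  then have "R \<inter> R' \<noteq> {}"
    using open_Int_closure_eq_empty[OF open_region_component[OF assms(1)], of R'] by blast
  then show ?thesis
    using components_nonoverlap[OF assms(1,2)] by blast
qed

lemma regions_eq: "regions E = closure ` components (- \<Union>E)"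
  by (simp add: regions_def Compl_eq_Diff_UNIV)

lemma vertex_regions:
  assumes "e \<in> E" "v \<in> e" "v \<in> V"
  obtains X Y Z where "X \<noteq> Y" "X \<noteq> Z" "Y \<noteq> Z" "X \<inter> Y = e"
    "{R \<in> regions E. e \<subseteq> R} = {X, Y}" "{R \<in> regions E. v \<in> R} = {X, Y, Z}"
    "\<forall>R\<in>{X, Y, Z}. \<exists>e'\<in>E. v \<in> e' \<and> \<not> e' \<subseteq> R"
proof -
  obtain X Y Z where XYZ: "X \<in> components (- \<Union>E)" "Y \<in> components (- \<Union>E)" "Z \<in> components (- \<Union>E)"
    "X \<noteq> Y" "X \<noteq> Z" "Y \<noteq> Z" "closure X \<inter> closure Y = e"
    and ed: "\<And>R. R \<in> components (- \<Union>E) \<Longrightarrow> closure R \<inter> (e - V) \<noteq> {} \<longleftrightarrow> R \<in> {X, Y}"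
    and ve: "\<And>R. R \<in> components (- \<Union>E) \<Longrightarrow> v \<in> closure R \<longleftrightarrow> R \<in> {X, Y, Z}"
    and op: "\<And>R. R \<in> {X, Y, Z} \<Longrightarrow> \<exists>e'\<in>E. v \<in> e' \<and> closure R \<inter> (e' - V) = {}"
    using vertex_components[OF assms] by metis
  have neq: "closure X \<noteq> closure Y" "closure X \<noteq> closure Z" "closure Y \<noteq> closure Z"
    using region_component_inj XYZ by metis+
  have "e \<subseteq> closure R \<longleftrightarrow> R \<in> {X, Y}" if "R \<in> components (- \<Union>E)" for R
  proof -
    have "e \<subseteq> closure R \<Longrightarrow> closure R \<inter> (e - V) \<noteq> {}"
      using edge_interior_nonempty[OF assms(1)] by blast
    moreover have "R \<in> {X, Y} \<Longrightarrow> e \<subseteq> closure R"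
      using XYZ(7) by blast
    ultimately show ?thesis
      using ed[OF that] by blast
  qed
  then have ed': "{R \<in> regions E. e \<subseteq> R} = {closure X, closure Y}"
    unfolding regions_eq using XYZ(1,2) by auto
  have ve': "{R \<in> regions E. v \<in> R} = {closure X, closure Y, closure Z}"
    unfolding regions_eq using ve XYZ(1-3) by auto
  have "\<exists>e'\<in>E. v \<in> e' \<and> \<not> e' \<subseteq> closure Q" if Q: "Q \<in> {X, Y, Z}" for Q
  proof -
    obtain e' where "e' \<in> E" "v \<in> e'" "closure Q \<inter> (e' - V) = {}"
      using op[OF Q] by (elim bexE conjE)
    then show ?thesis
      using edge_interior_nonempty[of e'] by blast
  qed
  then have "\<forall>R\<in>{closure X, closure Y, closure Z}. \<exists>e'\<in>E. v \<in> e' \<and> \<not> e' \<subseteq> R"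
    by simp
  then show ?thesis
    by (rule that[OF neq XYZ(7) ed' ve'])
qed

text \<open>The component is not the whole plane, so it has a frontier point, and this lies on the
  tree. If the point is inside an edge, the region is one of the two along that edge and contains
  its ends.\<close>

lemma region_has_vertex:
  assumes "R \<in> regions E"
  obtains v where "v \<in> R" "v \<in> V"
proof -
  obtain Q where Q: "Q \<in> components (- \<Union>E)" "R = closure Q"
    using assms unfolding regions_eq by blast
  have "infinite V"
    using tree unfolding trivalent_planar_tree_def by (elim conjE)
  then obtain u where "u \<in> V"
    using infinite_imp_nonempty by blast
  then obtain w where "adj u w"
    using another_neighbour by metis
  then have "u \<in> \<Union>E"
    using edg_props(1,2)[of u w] by blast
  then have "Q \<noteq> UNIV"
    using in_components_subset[OF Q(1)] by blast
  then have "frontier Q \<noteq> {}"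
    using in_components_nonempty[OF Q(1)] by (simp add: frontier_eq_empty)
  then obtain x e where x: "x \<in> frontier Q" "e \<in> E" "x \<in> e"
    using region_component_frontier[OF Q(1)] by blast
  then have xR: "x \<in> R"
    unfolding Q(2) by (simp add: frontier_def)
  show ?thesis
  proof (cases "x \<in> V")
    case True
    then show ?thesis
      using that xR by blast
  next
    case False
    obtain v where v: "v \<in> e" "v \<in> V"
      using edge_ends[OF x(2)] by blast
    obtain X Y Z where XYZ: "closure X \<inter> closure Y = e"
      "closure Q \<inter> (e - V) \<noteq> {} \<longleftrightarrow> Q \<in> {X, Y}"
      using vertex_components[OF x(2) v] Q(1) by metis
    then have "e \<subseteq> closure Q"
      using False x xR Q(2) by blast
    then show ?thesis
      using that v Q(2) by blast
  qed
qed

text \<open>The colouring, and the Markoff conditions at edges, speak only through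
  \<open>edge_rel\<close>; this supplies an instance at every edge. Both ends yield the same pair
  \<open>X\<close>, \<open>Y\<close> because it is determined by the edge.\<close>

lemma edge_rel_exists:
  assumes "e \<in> E" "e \<inter> V = {u, w}" "u \<noteq> w"
  obtains X Y Z W where "edge_rel V E e X Y Z W" "{R \<in> regions E. e \<subseteq> R} = {X, Y}"
    "{R \<in> regions E. u \<in> R} = {X, Y, Z}" "{R \<in> regions E. w \<in> R} = {X, Y, W}"
    "X \<noteq> Y" "X \<noteq> Z" "Y \<noteq> Z" "X \<noteq> W" "Y \<noteq> W"
proof -
  have uw: "u \<in> e" "u \<in> V" "w \<in> e" "w \<in> V"
    using assms(2) by blast+
  obtain X Y Z where XYZ: "X \<noteq> Y" "X \<noteq> Z" "Y \<noteq> Z" "X \<inter> Y = e"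
    "{R \<in> regions E. e \<subseteq> R} = {X, Y}" "{R \<in> regions E. u \<in> R} = {X, Y, Z}"
    "\<forall>R\<in>{X, Y, Z}. \<exists>e'\<in>E. u \<in> e' \<and> \<not> e' \<subseteq> R"
    by (rule vertex_regions[OF assms(1) uw(1,2)])
  obtain X' Y' W where XYW: "X' \<noteq> Y'" "X' \<noteq> W" "Y' \<noteq> W" "X' \<inter> Y' = e"
    "{R \<in> regions E. e \<subseteq> R} = {X', Y'}" "{R \<in> regions E. w \<in> R} = {X', Y', W}"
    "\<forall>R\<in>{X', Y', W}. \<exists>e'\<in>E. w \<in> e' \<and> \<not> e' \<subseteq> R"
    by (rule vertex_regions[OF assms(1) uw(3,4)])
  have XY: "{X, Y} = {X', Y'}"
    using XYZ(5) XYW(5) by simp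
  then have XW: "X \<noteq> W" "Y \<noteq> W" and w: "{R \<in> regions E. w \<in> R} = {X, Y, W}"
    using XYW by (auto simp: doubleton_eq_iff)
  have in_reg: "X \<in> regions E" "Y \<in> regions E" "Z \<in> regions E" "u \<in> Z"
    using XYZ(6) by blast+
  have W: "W \<in> regions E" "w \<in> W"
    using w by blast+
  have "Z \<notin> {X, Y}" "W \<notin> {X, Y}"
    using XYZ(2,3) XW by simp_all
  then have "edge_rel V E e X Y Z W"
    unfolding edge_rel_def
    by (intro conjI exI[of _ u] exI[of _ w] assms in_reg W XYZ(1,4))
  then show ?thesis
    by (rule that[OF _ XYZ(5,6) w XYZ(1-3) XW])
qed

end

subsection \<open>Estimates for Markoff maps\<close>

lemma sum_of_norms4: "cmod (a + b + c + d) \<le> cmod a + cmod b + cmod c + cmod d"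
  using norm_triangle_ineq[of "a + b + c" d] norm_triangle_ineq[of "a + b" c] norm_triangle_ineq[of a b]
  by linarith

text \<open>The quadratic equation for the largest value shows that it is at most 4 times the
  second. The vertex equation then bounds the product of the two smaller values by 7 times the
  largest, hence by 28 times the second, which bounds the smallest by 28.\<close>

lemma no_large_approximate_sink_ordered:
  fixes x y z x' a b c s :: complex
  assumes coeffs: "cmod a \<le> M" "cmod b \<le> M" "cmod c \<le> M" "cmod s \<le> M"
    and large: "cmod x > 29 + M" "cmod y > 29 + M" "cmod z > 29 + M"
    and vertex: "x\<^sup>2 + y\<^sup>2 + z\<^sup>2 + x * y * z = a * x + b * y + c * z + s"
    and edge: "x + x' = a - y * z"
    and order: "cmod x \<ge> cmod y" "cmod y \<ge> cmod z" and sink: "cmod x' \<ge> cmod x / 2"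
  shows False
proof -
  let ?X = "cmod x" and ?Y = "cmod y" and ?Z = "cmod z"
  have M: "M \<ge> 0"
    using coeffs(1) norm_ge_zero[of a] by linarith
  have pos: "?X > 1" "?Y > 1" "?Z > 1" "?X \<ge> M" "?Y \<ge> M" "?Z \<ge> M"
    using large M by auto
  have small: "cmod (t * w) \<le> R\<^sup>2" if "cmod t \<le> M" "M \<le> R" "cmod w \<le> R" for t w :: complex and R
    using mult_mono[of "cmod t" R "cmod w" R] that M by (simp add: norm_mult power2_eq_square)
  have s: "cmod s \<le> ?Y\<^sup>2" "cmod s \<le> ?X\<^sup>2"
    using small[OF coeffs(4) pos(5), of 1] small[OF coeffs(4) pos(4), of 1] pos by auto
  have le: "?Z\<^sup>2 \<le> ?Y\<^sup>2" "?Y\<^sup>2 \<le> ?X\<^sup>2"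
    using order by (auto intro: power_mono)
  \<comment> \<open>For fixed \<open>y\<close> and \<open>z\<close>, \<open>x\<close> and
    \<open>x'\<close> are the two roots of the vertex equation; this is the product of the
    roots.\<close>
  have "x * x' = y\<^sup>2 + z\<^sup>2 + (- (b * y) + - (c * z)) + - s"
  proof -
    have "x' = a - y * z - x"
      using edge by (simp add: algebra_simps)
    then have "x * x' = a * x - x * y * z - x\<^sup>2"
      by (simp only: right_diff_distrib power2_eq_square mult_ac)
    also have "\<dots> = y\<^sup>2 + z\<^sup>2 + (- (b * y) + - (c * z)) + - s"
      using vertex by (simp add: algebra_simps)
    finally show ?thesis .
  qed
  then have "cmod (x * x') \<le> cmod (y\<^sup>2) + cmod (z\<^sup>2) + cmod (- (b * y) + - (c * z)) + cmod (- s)"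
    using sum_of_norms4 by metis
  \<comment> \<open>Two squares, two linear terms and \<open>s\<close>, each at most the square of
    the second largest absolute value.\<close>
  also have "\<dots> \<le> ?Y\<^sup>2 + ?Y\<^sup>2 + (?Y\<^sup>2 + ?Y\<^sup>2) + ?Y\<^sup>2"
    using le s small[OF coeffs(2) pos(5) order_refl] small[OF coeffs(3) pos(5) order(2)]
      norm_triangle_ineq[of "- (b * y)" "- (c * z)"]
    unfolding norm_power norm_minus_cancel by linarith
  finally have "?X * cmod x' \<le> 5 * ?Y\<^sup>2"
    by (simp add: norm_mult)
  moreover have "?X * (?X / 2) \<le> ?X * cmod x'"
    using sink by (intro mult_left_mono) auto
  ultimately have "?X\<^sup>2 \<le> 10 * ?Y\<^sup>2"
    by (simp add: power2_eq_square)
  \<comment> \<open>The bound 10 is relaxed to the perfect square 16.\<close>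
  moreover have "(4 * ?Y)\<^sup>2 = 16 * ?Y\<^sup>2"
    by (simp add: power_mult_distrib)
  ultimately have "?X\<^sup>2 \<le> (4 * ?Y)\<^sup>2"
    using zero_le_power2[of ?Y] by linarith
  then have XY: "?X \<le> 4 * ?Y"
    by (rule power2_le_imp_le) simp
  have "x * y * z = (a * x + b * y + c * z + s) + (- (x\<^sup>2) + - (y\<^sup>2) + - (z\<^sup>2) + 0)"
    using vertex by (simp add: algebra_simps)
  then have "cmod (x * y * z) \<le> cmod (a * x + b * y + c * z + s) + cmod (- (x\<^sup>2) + - (y\<^sup>2) + - (z\<^sup>2) + 0)"
    using norm_triangle_ineq by metis
  also have "\<dots> \<le> (cmod (a * x) + cmod (b * y) + cmod (c * z) + cmod s) +
      (cmod (- (x\<^sup>2)) + cmod (- (y\<^sup>2)) + cmod (- (z\<^sup>2)) + cmod 0)"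
    by (intro add_mono sum_of_norms4)
  \<comment> \<open>Three linear terms, \<open>s\<close> and three squares.\<close>
  also have "\<dots> \<le> 7 * ?X\<^sup>2"
    using s le small[OF coeffs(1) pos(4) order_refl] small[OF coeffs(2) pos(4) order(1)]
      small[OF coeffs(3) pos(4) order_trans[OF order(2,1)]]
    unfolding norm_power norm_minus_cancel norm_zero by linarith
  finally have "?X * (?Y * ?Z) \<le> ?X * (7 * ?X)"
    by (simp add: norm_mult power2_eq_square algebra_simps)
  then have "?Y * ?Z \<le> 7 * ?X"
    using pos(1) by (subst (asm) mult_le_cancel_left_pos) auto
  also have "\<dots> \<le> ?Y * 28"
    using XY by simp
  finally have "?Z \<le> 28"
    using pos(2) by (subst (asm) mult_le_cancel_left_pos) auto
  then show False
    using large(3) M by linarith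
qed

lemma no_large_approximate_sink:
  fixes x y z x' a b c s :: complex
  assumes coeffs: "cmod a \<le> M" "cmod b \<le> M" "cmod c \<le> M" "cmod s \<le> M"
    and large: "cmod x > 29 + M" "cmod y > 29 + M" "cmod z > 29 + M"
    and vertex: "x\<^sup>2 + y\<^sup>2 + z\<^sup>2 + x * y * z = a * x + b * y + c * z + s"
    and edge: "x + x' = a - y * z"
    and order: "cmod x \<ge> cmod y" "cmod x \<ge> cmod z" and sink: "cmod x' \<ge> cmod x / 2"
  shows False
proof (cases "cmod y \<ge> cmod z")
  case True
  then show ?thesis
    using no_large_approximate_sink_ordered[OF assms(1-10)] sink by blast
next
  case False
  have "x\<^sup>2 + z\<^sup>2 + y\<^sup>2 + x * z * y = a * x + c * z + b * y + s" "x + x' = a - z * y"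
    using vertex edge by (simp_all add: algebra_simps)
  then show ?thesis
    using no_large_approximate_sink_ordered[OF coeffs(1,3,2,4) large(1,3,2)] order(2) False sink by simp
qed

text \<open>Adding the bounds on the two products gives at most \<open>2 * M\<close> for the left
  side, while the size of the values forces at least \<open>4 * M\<close>. The separate strict
  positivity excludes the case \<open>M = 0\<close>.\<close>

lemma no_large_fork:
  fixes x y z x' y' a b :: complex
  assumes coeffs: "cmod a \<le> M" "cmod b \<le> M"
    and large: "cmod x > 2 + M" "cmod y > 2 + M" "cmod z > 2 + M"
    and edges: "x + x' = a - y * z" "y + y' = b - x * z"
    and descent: "cmod x' \<le> cmod x" "cmod y' \<le> cmod y"
  shows False
proof -
  have M: "M \<ge> 0"
    using coeffs(1) norm_ge_zero[of a] by linarith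
  have "y * z = a - (x + x')" "x * z = b - (y + y')"
    using edges by (simp_all add: algebra_simps)
  then have "cmod (y * z) \<le> cmod a + cmod (x + x')" "cmod (x * z) \<le> cmod b + cmod (y + y')"
    by (simp_all only: norm_triangle_ineq4)
  then have "cmod y * cmod z \<le> M + 2 * cmod x" "cmod x * cmod z \<le> M + 2 * cmod y"
    using norm_triangle_ineq[of x x'] norm_triangle_ineq[of y y'] coeffs descent
    by (simp_all add: norm_mult)
  then have "(cmod z - 2) * (cmod x + cmod y) \<le> 2 * M"
    by (simp add: algebra_simps)
  moreover have "M * 4 \<le> (cmod z - 2) * (cmod x + cmod y)" "(cmod z - 2) * (cmod x + cmod y) > 0"
    using large M by (auto intro!: mult_mono mult_pos_pos)
  ultimately show False
    using M by linarith
qed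

text \<open>Since \<open>k * k\<close> is at least \<open>2 * k + M\<close>, a product of two values
  above \<open>k\<close> is too large for the edge relation. This settles walks of a single edge:
  two ends in the sublevel set share a region belonging to it.\<close>

lemma no_large_edge:
  fixes x y z w a :: complex
  assumes "cmod a \<le> M" "k \<ge> 2 + M" "cmod x > k" "cmod y > k" "cmod z \<le> k" "cmod w \<le> k"
    "z + w = a - x * y"
  shows False
proof -
  have M: "M \<ge> 0"
    using assms(1) norm_ge_zero[of a] by linarith
  have "k * k < cmod x * cmod y"
    using assms M by (intro mult_strict_mono) auto
  also have "cmod x * cmod y \<le> M + 2 * k"
  proof -
    have "x * y = a - (z + w)"
      using assms(7) by (simp add: algebra_simps)
    then have "cmod (x * y) \<le> cmod a + cmod (z + w)"
      by (simp only: norm_triangle_ineq4)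
    then show ?thesis
      using norm_triangle_ineq[of z w] assms by (simp add: norm_mult)
  qed
  finally have "k * k < M + 2 * k" .
  moreover have "(2 + M) * k \<le> k * k"
    using assms(2) M by (intro mult_right_mono) auto
  moreover have "M * 1 \<le> M * k"
    using assms(2) M by (intro mult_left_mono) auto
  ultimately show False
    by (simp add: algebra_simps)
qed

section \<open>Opposite regions and colour-independent Markoff relations\<close>

locale coloured_tree = trivalent_tree +
  fixes colR colE :: "complex set \<Rightarrow> nat"
  assumes colouring: "admissible_coloring V E colR colE"
begin

definition regions_at :: "complex \<Rightarrow> complex set set" where
  "regions_at v = {R \<in> regions E. v \<in> R}"

text \<open>For an end \<open>v\<close> of \<open>e\<close> this is the region Z or W of
  e<->(X,Y;Z,W). Crossing the edge exchanges the opposite regions at its two ends and keeps the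
  other two regions.\<close>

definition opp :: "complex set \<Rightarrow> complex \<Rightarrow> complex set" where
  "opp e v = (THE Z. Z \<in> regions_at v \<and> \<not> e \<subseteq> Z)"

lemma edge_data:
  assumes "adj u w"
  obtains X Y where "edge_rel V E (edg u w) X Y (opp (edg u w) u) (opp (edg u w) w)"
    "regions_at u = {X, Y, opp (edg u w) u}" "regions_at w = {X, Y, opp (edg u w) w}"
    "X \<noteq> Y" "opp (edg u w) u \<noteq> X" "opp (edg u w) u \<noteq> Y" "opp (edg u w) w \<noteq> X" "opp (edg u w) w \<noteq> Y"
    "X \<inter> Y = edg u w"
proof -
  obtain X Y Z W where *: "edge_rel V E (edg u w) X Y Z W" "{R \<in> regions E. edg u w \<subseteq> R} = {X, Y}"
    "regions_at u = {X, Y, Z}" "regions_at w = {X, Y, W}" "X \<noteq> Y" "X \<noteq> Z" "Y \<noteq> Z" "X \<noteq> W" "Y \<noteq> W"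
    by (rule edge_rel_exists[OF edg_props(1)[OF assms] edg_props(4)[OF assms] adj_neq[OF assms],
        folded regions_at_def])
  have opp: "opp (edg u w) v = Q" if "regions_at v = {X, Y, Q}" "X \<noteq> Q" "Y \<noteq> Q" for v Q
    unfolding opp_def
  proof (rule the_equality)
    have "R \<in> regions_at v \<and> \<not> edg u w \<subseteq> R \<longleftrightarrow> R \<in> {X, Y, Q} \<and> R \<notin> {X, Y}" for R
      using *(2) that(1) unfolding regions_at_def by blast
    then show "Q \<in> regions_at v \<and> \<not> edg u w \<subseteq> Q" "\<And>Z. Z \<in> regions_at v \<and> \<not> edg u w \<subseteq> Z \<Longrightarrow> Z = Q"
      using that by auto
  qed
  have "X \<inter> Y = edg u w"
    using *(1) by (simp add: edge_rel_def)
  moreover have "opp (edg u w) u = Z" "opp (edg u w) w = W"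
    using opp[OF *(3,6,7)] opp[OF *(4,8,9)] by simp_all
  ultimately show ?thesis
    using that[of X Y] *(1,3-9) by simp
qed

text \<open>Any chosen value at a vertex can be replaced by crossing a suitable edge, because every
  region there fails to contain one of the edges.\<close>

lemma opp_surj:
  assumes "v \<in> V" "R \<in> regions_at v"
  obtains w where "adj v w" "opp (edg v w) v = R"
proof -
  obtain w0 where w0: "adj v w0"
    using another_neighbour[OF assms(1), of v v] by blast
  obtain X Y Z where XYZ: "X \<noteq> Y" "X \<noteq> Z" "Y \<noteq> Z" "X \<inter> Y = edg v w0"
    "{R \<in> regions E. edg v w0 \<subseteq> R} = {X, Y}" "{R \<in> regions E. v \<in> R} = {X, Y, Z}"
    "\<forall>R\<in>{X, Y, Z}. \<exists>e'\<in>E. v \<in> e' \<and> \<not> e' \<subseteq> R"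
    by (rule vertex_regions[OF edg_props(1,2)[OF w0] assms(1)])
  have "R \<in> {X, Y, Z}"
    using assms(2) unfolding regions_at_def XYZ(6) .
  obtain e where e: "e \<in> E" "v \<in> e" "\<not> e \<subseteq> R"
    using bspec[OF XYZ(7) \<open>R \<in> {X, Y, Z}\<close>] by (elim bexE conjE)
  obtain w where w: "adj v w" "e = edg v w"
    using edge_eq_edg[OF e(1,2) assms(1)] .
  obtain X Y where "regions_at v = {X, Y, opp (edg v w) v}" "X \<inter> Y = edg v w"
    by (rule edge_data[OF w(1)])
  then have "opp (edg v w) v = R"
    using e(3) w(2) assms(2) by blast
  then show ?thesis
    using that w(1) by blast
qed

text \<open>Attaching the linear coefficient to the region removes the colours from the Markoff
  relations, so that the estimates can name the three regions in any order.\<close>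

definition coef :: "complex \<Rightarrow> complex \<Rightarrow> complex \<Rightarrow> complex set \<Rightarrow> complex" where
  "coef p q r R = (if colR R = 1 then p else if colR R = 2 then q else r)"

lemma norm_coef_le: "cmod (coef p q r R) \<le> cmod p + cmod q + cmod r + cmod s"
  by (simp add: coef_def)

lemma edge_colours:
  assumes "edge_rel V E e X Y Z W"
  shows "colE e = colR Z" "colE e = colR W" "colR Z \<in> {1, 2, 3}" "colR X \<in> {1, 2, 3}" "colR Y \<in> {1, 2, 3}"
    "colR Z \<noteq> colR X" "colR Z \<noteq> colR Y" "colR X \<noteq> colR Y"
proof -
  note col = colouring[unfolded admissible_coloring_def, THEN conjunct1]
    colouring[unfolded admissible_coloring_def, THEN conjunct2, THEN conjunct2]
  have "X \<in> regions E" "Y \<in> regions E" "Z \<in> regions E"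
    using assms by (simp_all add: edge_rel_def)
  then show "colR Z \<in> {1, 2, 3}" "colR X \<in> {1, 2, 3}" "colR Y \<in> {1, 2, 3}"
    using col(1) by blast+
  show "colE e = colR Z" "colE e = colR W" "colR Z \<noteq> colR X" "colR Z \<noteq> colR Y" "colR X \<noteq> colR Y"
    using col(2)[rule_format, OF assms] by simp_all
qed

lemma markoff_edge:
  assumes "markoff_map V E colR colE p q r s \<phi>" "edge_rel V E e X Y Z W"
  shows "\<phi> Z + \<phi> W = coef p q r Z - \<phi> X * \<phi> Y"
proof -
  note m' = assms(1)[unfolded markoff_map_def, THEN conjunct2]
  note m = m'[THEN conjunct1] m'[THEN conjunct2, THEN conjunct1] m'[THEN conjunct2, THEN conjunct2]
  consider "colE e = 1" | "colE e = 2" | "colE e = 3"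
    using edge_colours(1,3)[OF assms(2)] by auto
  then show ?thesis
  proof cases
    case 1
    then show ?thesis
      using m(1)[rule_format, of e X Y Z W] assms(2) edge_colours(1)[OF assms(2)] by (simp add: coef_def)
  next
    case 2
    then show ?thesis
      using m(2)[rule_format, of e X Y Z W] assms(2) edge_colours(1)[OF assms(2)] by (simp add: coef_def)
  next
    case 3
    then show ?thesis
      using m(3)[rule_format, of e X Y Z W] assms(2) edge_colours(1)[OF assms(2)] by (simp add: coef_def)
  qed
qed

lemma markoff_vertex:
  assumes "markoff_map V E colR colE p q r s \<phi>" "edge_rel V E e X Y Z W"
    "v \<in> V" "v \<in> X" "v \<in> Y" "v \<in> Z"
  shows "(\<phi> Z)\<^sup>2 + (\<phi> X)\<^sup>2 + (\<phi> Y)\<^sup>2 + \<phi> Z * \<phi> X * \<phi> Y =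
    coef p q r Z * \<phi> Z + coef p q r X * \<phi> X + coef p q r Y * \<phi> Y + s"
proof -
  note vert = assms(1)[unfolded markoff_map_def, THEN conjunct1]
  have "X \<in> regions E" "Y \<in> regions E" "Z \<in> regions E"
    using assms(2) by (simp_all add: edge_rel_def)
  then have reg: "Q \<in> regions E" "v \<in> Q" if "Q \<in> {X, Y, Z}" for Q
    using that assms(4-6) by (elim insertE emptyE; simp)+
  have m: "(\<phi> A)\<^sup>2 + (\<phi> B)\<^sup>2 + (\<phi> C)\<^sup>2 + \<phi> A * \<phi> B * \<phi> C = p * \<phi> A + q * \<phi> B + r * \<phi> C + s"
    if "A \<in> {X, Y, Z}" "B \<in> {X, Y, Z}" "C \<in> {X, Y, Z}" "colR A = 1" "colR B = 2" "colR C = 3" for A B C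
    by (rule vert[rule_format, OF assms(3) reg(1)[OF that(1)] reg(1)[OF that(2)] reg(1)[OF that(3)]])
      (intro conjI reg(2) that)
  note c = edge_colours[OF assms(2)]
  consider "colR X = 1" "colR Y = 2" "colR Z = 3" | "colR X = 1" "colR Y = 3" "colR Z = 2"
    | "colR X = 2" "colR Y = 1" "colR Z = 3" | "colR X = 2" "colR Y = 3" "colR Z = 1"
    | "colR X = 3" "colR Y = 1" "colR Z = 2" | "colR X = 3" "colR Y = 2" "colR Z = 1"
    using c(3-8) by auto
  then show ?thesis
  proof cases
    case 1 then show ?thesis using m[of X Y Z] by (simp add: coef_def algebra_simps)
  next
    case 2 then show ?thesis using m[of X Z Y] by (simp add: coef_def algebra_simps)
  next
    case 3 then show ?thesis using m[of Y X Z] by (simp add: coef_def algebra_simps)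
  next
    case 4 then show ?thesis using m[of Z X Y] by (simp add: coef_def algebra_simps)
  next
    case 5 then show ?thesis using m[of Y Z X] by (simp add: coef_def algebra_simps)
  next
    case 6 then show ?thesis using m[of Z Y X] by (simp add: coef_def algebra_simps)
  qed
qed

section \<open>Existence of a small region\<close>

lemma V_nonempty: "V \<noteq> {}"
proof -
  have "infinite V"
    using tree unfolding trivalent_planar_tree_def by (elim conjE)
  then show ?thesis
    by (rule infinite_imp_nonempty)
qed

lemma connected_region: "R \<in> regions E \<Longrightarrow> connected R"
  unfolding regions_eq using in_components_connected connected_imp_connected_closure by blast

lemma regions_at_card:
  assumes "v \<in> V"
  shows "card (regions_at v) = 3"
proof -
  obtain w where w: "adj v w"
    using another_neighbour[OF assms, of v v] by blast
  obtain X Y where "regions_at v = {X, Y, opp (edg v w) v}" "X \<noteq> Y"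
    "opp (edg v w) v \<noteq> X" "opp (edg v w) v \<noteq> Y"
    by (rule edge_data[OF w])
  then show ?thesis
    by simp
qed

lemma some_region_small:
  assumes \<phi>: "markoff_map V E colR colE p q r s \<phi>"
  defines "l \<equiv> 29 + (cmod p + cmod q + cmod r + cmod s)"
  shows "Omega_phi E \<phi> l \<noteq> {}"
proof
  assume "Omega_phi E \<phi> l = {}"
  then have large: "cmod (\<phi> R) > l" if "R \<in> regions E" for R
    using that by (auto simp: Omega_phi_def not_le)
  define N where "N v = (\<Prod>R\<in>regions_at v. cmod (\<phi> R))" for v
  have l1: "l \<ge> 1"
    by (simp add: l_def)
  have "N v \<ge> 1" if "v \<in> V" for v
    unfolding N_def
  proof (rule prod_ge_1)
    fix R assume "R \<in> regions_at v"
    then show "1 \<le> cmod (\<phi> R)"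
      using large[of R] l1 by (simp add: regions_at_def)
  qed
  then have Inf1: "1 \<le> Inf (N ` V)" and bdd: "bdd_below (N ` V)"
    using V_nonempty by (auto intro!: cInf_greatest bdd_belowI[of _ 1])
  \<comment> \<open>Positivity of the infimum is what makes room for a vertex below twice its
    value.\<close>
  then have "Inf (N ` V) < 2 * Inf (N ` V)"
    by linarith
  then obtain v where v: "v \<in> V" "N v < 2 * Inf (N ` V)"
    using V_nonempty cInf_lessD[of "N ` V"] by blast
  have near_min: "N v < 2 * N w" if "w \<in> V" for w
    using v(2) cInf_lower[OF imageI[OF that, of N] bdd] by linarith
  have "finite (regions_at v)" "regions_at v \<noteq> {}"
    using regions_at_card[OF v(1)] card.infinite by fastforce+
  then have "Max ((\<lambda>R. cmod (\<phi> R)) ` regions_at v) \<in> (\<lambda>R. cmod (\<phi> R)) ` regions_at v"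
    by (intro Max_in) auto
  then obtain Z where Z_in: "Z \<in> regions_at v"
    and Z_eq: "Max ((\<lambda>R. cmod (\<phi> R)) ` regions_at v) = cmod (\<phi> Z)"
    by (rule imageE)
  have "cmod (\<phi> R) \<le> cmod (\<phi> Z)" if "R \<in> regions_at v" for R
    unfolding Z_eq[symmetric] using that \<open>finite (regions_at v)\<close> by (intro Max_ge) auto
  note Z = Z_in this
  \<comment> \<open>Crossing the edge opposite the largest region changes only that factor of the
    product, so near-minimality says that the new value exceeds half the old one.\<close>
  obtain w where w: "adj v w" "opp (edg v w) v = Z"
    using opp_surj[OF v(1) Z(1)] .
  define W where "W = opp (edg v w) w"
  obtain X Y where XY: "edge_rel V E (edg v w) X Y Z W" "regions_at v = {X, Y, Z}" "regions_at w = {X, Y, W}"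
    "X \<noteq> Y" "Z \<noteq> X" "Z \<noteq> Y" "W \<noteq> X" "W \<noteq> Y"
    by (rule edge_data[OF w(1), unfolded w(2), folded W_def])
  have reg: "X \<in> regions E" "Y \<in> regions E" "Z \<in> regions E" "v \<in> X" "v \<in> Y" "v \<in> Z"
    using XY(2) unfolding regions_at_def by blast+
  have "N v = cmod (\<phi> X) * cmod (\<phi> Y) * cmod (\<phi> Z)" "N w = cmod (\<phi> X) * cmod (\<phi> Y) * cmod (\<phi> W)"
    unfolding N_def XY(2,3) using XY(4-8) by (simp_all add: algebra_simps)
  then have "(cmod (\<phi> X) * cmod (\<phi> Y)) * cmod (\<phi> Z) < (cmod (\<phi> X) * cmod (\<phi> Y)) * (2 * cmod (\<phi> W))"
    using near_min[OF adj_in_V(2)[OF w(1)]] by simp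
  moreover have "cmod (\<phi> X) > 0" "cmod (\<phi> Y) > 0"
    using large[OF reg(1)] large[OF reg(2)] l1 by linarith+
  then have "0 < cmod (\<phi> X) * cmod (\<phi> Y)"
    by simp
  ultimately have "cmod (\<phi> Z) < 2 * cmod (\<phi> W)"
    by (simp only: mult_less_cancel_left_pos)
  then have "cmod (\<phi> Z) / 2 \<le> cmod (\<phi> W)"
    by simp
  moreover have "cmod s \<le> cmod p + cmod q + cmod r + cmod s"
    by simp
  ultimately show False
    using no_large_approximate_sink[OF norm_coef_le[of p q r _ s] norm_coef_le[of p q r _ s] norm_coef_le[of p q r _ s] _ _ _ _
        markoff_vertex[OF \<phi> XY(1) v(1) reg(4-6)] markoff_edge[OF \<phi> XY(1)]]
      large[OF reg(1)] large[OF reg(2)] large[OF reg(3)] Z(2)[of X] Z(2)[of Y] XY(2)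
    unfolding l_def by simp
qed

section \<open>Connectedness of sublevel sets\<close>

lemma no_large_fork_at:
  assumes \<phi>: "markoff_map V E colR colE p q r s \<phi>"
    and adj: "adj v u" "adj v w" "u \<noteq> w"
    and large: "\<And>R. R \<in> regions_at v \<Longrightarrow> cmod (\<phi> R) > 2 + (cmod p + cmod q + cmod r + cmod s)"
    and desc: "cmod (\<phi> (opp (edg v u) u)) \<le> cmod (\<phi> (opp (edg v u) v))"
      "cmod (\<phi> (opp (edg v w) w)) \<le> cmod (\<phi> (opp (edg v w) v))"
  shows False
proof -
  define A where "A = opp (edg v u) v"
  define B where "B = opp (edg v w) v"
  obtain X Y where XY: "edge_rel V E (edg v u) X Y A (opp (edg v u) u)" "regions_at v = {X, Y, A}"
    "X \<noteq> Y" "A \<noteq> X" "A \<noteq> Y" "X \<inter> Y = edg v u"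
    by (rule edge_data[OF adj(1), folded A_def])
  obtain X' Y' where XY': "edge_rel V E (edg v w) X' Y' B (opp (edg v w) w)" "regions_at v = {X', Y', B}"
    "X' \<noteq> Y'" "B \<noteq> X'" "B \<noteq> Y'" "X' \<inter> Y' = edg v w"
    by (rule edge_data[OF adj(2), folded B_def])
  have "edg v u \<noteq> edg v w"
    using edg_props(4)[OF adj(1)] edg_props(4)[OF adj(2)] adj(3) by (auto simp: doubleton_eq_iff)
  have sets: "{X, Y, A} = {X', Y', B}"
    using XY(2) XY'(2) by simp
  have pairs: "{X, Y} = {X, Y, A} - {A}" "{X', Y'} = {X, Y, A} - {B}"
  proof -
    show "{X, Y} = {X, Y, A} - {A}"
      using XY(4,5) by auto
    show "{X', Y'} = {X, Y, A} - {B}"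
      unfolding sets using XY'(4,5) by auto
  qed
  \<comment> \<open>An edge is the intersection of the two regions at \<open>v\<close> other than
    its opposite one, so different edges have different opposite regions. With \<open>C\<close> the
    third region, the two edge relations take the form needed for
    \<open>no_large_fork\<close>.\<close>
  have "A \<noteq> B"
  proof
    assume "A = B"
    then have "\<Inter>{X, Y} = \<Inter>{X', Y'}"
      using pairs by simp
    then show False
      using XY(6) XY'(6) \<open>edg v u \<noteq> edg v w\<close> by simp
  qed
  moreover have "B \<in> {X, Y, A}"
    unfolding sets by simp
  ultimately have "B = X \<or> B = Y"
    by simp
  then obtain C where C: "{X, Y} = {B, C}" "{X', Y'} = {A, C}" "C \<in> regions_at v"
  proof
    assume "B = X"
    moreover from this have "{X', Y'} = {A, Y}"
      using XY(3-5) unfolding pairs(2) by auto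
    ultimately show thesis
      using that[of Y] XY(2) by simp
  next
    assume "B = Y"
    moreover from this have "{X', Y'} = {A, X}"
      using XY(3-5) unfolding pairs(2) by auto
    ultimately show thesis
      using that[of X] XY(2) by (simp add: insert_commute)
  qed
  have "\<phi> X * \<phi> Y = \<phi> B * \<phi> C" "\<phi> X' * \<phi> Y' = \<phi> A * \<phi> C"
    using C(1,2) by (auto simp: doubleton_eq_iff)
  then have "\<phi> A + \<phi> (opp (edg v u) u) = coef p q r A - \<phi> B * \<phi> C"
    "\<phi> B + \<phi> (opp (edg v w) w) = coef p q r B - \<phi> A * \<phi> C"
    using markoff_edge[OF \<phi> XY(1)] markoff_edge[OF \<phi> XY'(1)] by simp_all
  moreover have "A \<in> regions_at v" "B \<in> regions_at v"
    using \<open>B \<in> {X, Y, A}\<close> unfolding XY(2) by simp_all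
  ultimately show False
    using no_large_fork[OF norm_coef_le[of p q r A s] norm_coef_le[of p q r B s], of "\<phi> A" "\<phi> B" "\<phi> C"] large C(3)
      desc[folded A_def B_def] by blast
qed

text \<open>Induction on length: a walk is split at an inner vertex of the sublevel set, and a
  backtrack is cut out. What remains is trivial, a single edge, or an excursion with all inner
  values above \<open>k\<close>, which is impossible.\<close>

lemma walk_in_sublevel_set:
  assumes \<phi>: "markoff_map V E colR colE p q r s \<phi>"
    and k: "k \<ge> 2 + (cmod p + cmod q + cmod r + cmod s)"
    and walk: "\<And>i. i < n \<Longrightarrow> adj (f i) (f (Suc i))" "f 0 \<in> V"
    and ends: "f 0 \<in> \<Union>(Omega_phi E \<phi> k)" "f n \<in> \<Union>(Omega_phi E \<phi> k)"
  shows "connected_component (\<Union>(Omega_phi E \<phi> k)) (f 0) (f n)"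
  using walk ends
proof (induction n arbitrary: f rule: less_induct)
  case (less n)
  define U where "U = \<Union>(Omega_phi E \<phi> k)"
  have inU: "v \<in> U \<longleftrightarrow> (\<exists>R\<in>regions_at v. cmod (\<phi> R) \<le> k)" for v
    unfolding U_def Omega_phi_def regions_at_def by blast
  have same_region: "connected_component U x y" if "R \<in> regions E" "cmod (\<phi> R) \<le> k" "x \<in> R" "y \<in> R" for R x y
  proof -
    have "R \<subseteq> U"
      using that unfolding U_def Omega_phi_def by blast
    moreover have "connected R"
      using connected_region[OF that(1)] .
    ultimately show ?thesis
      using that unfolding connected_component_def by blast
  qed
  have ends: "f 0 \<in> U" "f n \<in> U"
    using less.prems unfolding U_def by auto
  consider "n = 0" | m where "0 < m" "m < n" "f m \<in> U" | m where "Suc (Suc m) \<le> n" "f m = f (Suc (Suc m))"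
    | "n > 0" "\<And>m. 0 < m \<Longrightarrow> m < n \<Longrightarrow> f m \<notin> U" "\<And>m. Suc (Suc m) \<le> n \<Longrightarrow> f m \<noteq> f (Suc (Suc m))"
    by blast
  then have "connected_component U (f 0) (f n)"
  proof cases
    case 1
    then show ?thesis
      using ends(1) by (simp add: connected_component_refl)
  next
    case (2 m)
    have "connected_component U (f 0) (f m)"
      using less.IH[OF 2(2), of f] less.prems 2 unfolding U_def by simp
    moreover have "connected_component U (f (m + 0)) (f (m + (n - m)))"
      unfolding U_def
    proof (rule less.IH)
      show "n - m < n"
        using 2 by simp
      show "adj (f (m + i)) (f (m + Suc i))" if "i < n - m" for i
        using less.prems(1)[of "m + i"] that by simp
      show "f (m + 0) \<in> V"
        using less.prems(1)[of m] 2 adj_in_V(1) by simp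
      show "f (m + 0) \<in> \<Union>(Omega_phi E \<phi> k)" "f (m + (n - m)) \<in> \<Union>(Omega_phi E \<phi> k)"
        using 2 ends unfolding U_def by simp_all
    qed
    ultimately show ?thesis
      using 2 connected_component_trans[of U "f 0" "f m" "f n"] by simp
  next
    case (3 m)
    define g where "g i = (if i \<le> m then f i else f (i + 2))" for i
    have "connected_component U (g 0) (g (n - 2))"
      unfolding U_def
    proof (rule less.IH)
      show "n - 2 < n"
        using 3 by simp
      show "adj (g i) (g (Suc i))" if "i < n - 2" for i
        using less.prems(1)[of i] less.prems(1)[of "Suc (Suc i)"] that 3(2)
        by (cases i m rule: linorder_cases) (auto simp: g_def)
      have "g (n - 2) = f n"
        using 3 by (cases "n - 2 = m") (auto simp: g_def numeral_2_eq_2 Suc_diff_Suc)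
      then show "g 0 \<in> V" "g 0 \<in> \<Union>(Omega_phi E \<phi> k)" "g (n - 2) \<in> \<Union>(Omega_phi E \<phi> k)"
        using less.prems unfolding g_def by simp_all
    qed
    moreover have "g (n - 2) = f n"
      using 3 by (cases "n - 2 = m") (auto simp: g_def numeral_2_eq_2 Suc_diff_Suc)
    ultimately show ?thesis
      by (simp add: g_def)
  next
    case 4
    \<comment> \<open>The values opposite the \<open>i\<close>-th edge at its start and at its end;
      the edge descends along the walk when \<open>a i > b i\<close>.\<close>
    define a where "a i = cmod (\<phi> (opp (edg (f i) (f (Suc i))) (f i)))" for i
    define b where "b i = cmod (\<phi> (opp (edg (f i) (f (Suc i))) (f (Suc i))))" for i
    show ?thesis
    proof (cases "n = 1")
      case True
      have adj: "adj (f 0) (f 1)"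
        using less.prems(1)[of 0] True by simp
      define Z where "Z = opp (edg (f 0) (f 1)) (f 0)"
      define W where "W = opp (edg (f 0) (f 1)) (f 1)"
      obtain X Y where XY: "edge_rel V E (edg (f 0) (f 1)) X Y Z W"
        "regions_at (f 0) = {X, Y, Z}" "regions_at (f 1) = {X, Y, W}"
        by (rule edge_data[OF adj, folded Z_def W_def])
      have "cmod (\<phi> X) \<le> k \<or> cmod (\<phi> Y) \<le> k"
      proof (rule ccontr)
        assume "\<not> ?thesis"
        then have "cmod (\<phi> X) > k" "cmod (\<phi> Y) > k"
          by auto
        moreover from this have "cmod (\<phi> Z) \<le> k" "cmod (\<phi> W) \<le> k"
          using ends True inU[of "f 0"] inU[of "f 1"] XY(2,3) by auto
        ultimately show False
          using no_large_edge[OF norm_coef_le[of p q r _ s] k _ _ _ _ markoff_edge[OF \<phi> XY(1)]] by blast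
      qed
      moreover have "X \<in> regions E" "Y \<in> regions E" "f 0 \<in> X" "f 0 \<in> Y" "f 1 \<in> X" "f 1 \<in> Y"
        using XY(2,3) unfolding regions_at_def by blast+
      ultimately show ?thesis
        using same_region True by metis
    next
      case False
      then have n2: "Suc 0 < n"
        using 4(1) by simp
      have large: "cmod (\<phi> R) > k" if "R \<in> regions_at (f i)" "0 < i" "i < n" for R i
        using 4(2)[OF that(2,3)] inU[of "f i"] that(1) by (meson not_le)
      \<comment> \<open>The two regions shared with the next vertex are large, so the small one at
        the start must be opposite the first edge. The last edge is treated in the same way from the
        other end.\<close>
      have "a 0 \<le> b 0"
      proof -
        obtain X Y where XY: "regions_at (f 0) = {X, Y, opp (edg (f 0) (f (Suc 0))) (f 0)}"
          "regions_at (f (Suc 0)) = {X, Y, opp (edg (f 0) (f (Suc 0))) (f (Suc 0))}"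
          by (rule edge_data[OF less.prems(1)[OF 4(1)]])
        then have "cmod (\<phi> X) > k" "cmod (\<phi> Y) > k" "b 0 > k"
          using large[OF _ _ n2] unfolding b_def by auto
        moreover from this have "a 0 \<le> k"
          using ends(1) inU[of "f 0"] XY(1) unfolding a_def by auto
        ultimately show ?thesis
          by simp
      qed
      obtain j where j: "n = Suc j" "0 < j"
        using n2 by (cases n) auto
      have "a j > b j"
      proof -
        have adj: "adj (f j) (f (Suc j))"
          using less.prems(1)[of j] j by simp
        obtain X Y where XY: "regions_at (f j) = {X, Y, opp (edg (f j) (f (Suc j))) (f j)}"
          "regions_at (f (Suc j)) = {X, Y, opp (edg (f j) (f (Suc j))) (f (Suc j))}"
          by (rule edge_data[OF adj])
        then have "cmod (\<phi> X) > k" "cmod (\<phi> Y) > k" "a j > k"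
          using large[of _ j] j unfolding a_def by auto
        moreover from this have "b j \<le> k"
          using ends(2) inU[of "f n"] XY(2) j unfolding b_def by auto
        ultimately show ?thesis
          by simp
      qed
      \<comment> \<open>At the start of the first descending edge, the preceding edge does not
        descend towards this vertex. Both edges thus lead away from it to values that are no
        larger.\<close>
      define m where "m = (LEAST m. a m > b m)"
      have m: "a m > b m" "m \<le> j"
        unfolding m_def using \<open>a j > b j\<close> by (auto intro: LeastI Least_le)
      have "m \<noteq> 0"
        using m(1) \<open>a 0 \<le> b 0\<close> by (metis not_le)
      then obtain i where i: "m = Suc i"
        by (cases m) auto
      have "a i \<le> b i"
        using not_less_Least[of i "\<lambda>m. a m > b m"] i unfolding m_def[symmetric] by simp
      have "m < n"
        using m(2) j by simp
      have adj: "adj (f m) (f i)" "adj (f m) (f (Suc m))" "f i \<noteq> f (Suc m)"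
        using less.prems(1)[of i] less.prems(1)[of m] 4(3)[of i] \<open>m < n\<close> i adj_sym by auto
      have "edg (f i) (f m) = edg (f m) (f i)"
        using edg_commute[OF adj(1)] by simp
      then have "cmod (\<phi> (opp (edg (f m) (f i)) (f i))) \<le> cmod (\<phi> (opp (edg (f m) (f i)) (f m)))"
        using \<open>a i \<le> b i\<close> unfolding a_def b_def i by simp
      moreover have "cmod (\<phi> (opp (edg (f m) (f (Suc m))) (f (Suc m)))) \<le> cmod (\<phi> (opp (edg (f m) (f (Suc m))) (f m)))"
        using m(1) unfolding a_def b_def by simp
      moreover have "2 + (cmod p + cmod q + cmod r + cmod s) < cmod (\<phi> R)" if "R \<in> regions_at (f m)" for R
        using large[OF that _ \<open>m < n\<close>] \<open>m \<noteq> 0\<close> k by fastforce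
      ultimately have False
        using no_large_fork_at[OF \<phi> adj] by blast
      then show ?thesis ..
    qed
  qed
  then show ?case
    unfolding U_def .
qed

text \<open>A chain of \<open>adjacent_vertices\<close> may pass through interior points of edges,
  so the induction concerns all vertices on edges through the point reached. An interior point lies
  on just one edge and creates no new way on.\<close>

lemma adjacent_imp_adj_path:
  assumes "(adjacent_vertices E)\<^sup>*\<^sup>* u x" "u \<in> V"
  shows "\<forall>e\<in>E. x \<in> e \<longrightarrow> (\<forall>w\<in>V. w \<in> e \<longrightarrow> adj\<^sup>*\<^sup>* u w)"
  using assms
proof (induction rule: rtranclp_induct)
  case base
  show ?case
  proof (intro ballI impI)
    fix e w assume "e \<in> E" "u \<in> e" "w \<in> V" "w \<in> e"
    then have "u = w \<or> adj u w"
      using assms(2) unfolding adj_def by blast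
    then show "adj\<^sup>*\<^sup>* u w"
      by auto
  qed
next
  case (step x y)
  obtain e0 where e0: "e0 \<in> E" "x \<in> e0" "y \<in> e0"
    using step.hyps(2) unfolding adjacent_vertices_def by blast
  have IH: "adj\<^sup>*\<^sup>* u w" if "w \<in> V" "w \<in> e0" for w
    using step.IH[OF assms(2)] e0 that by blast
  show ?case
  proof (intro ballI impI)
    fix e w assume e: "e \<in> E" "y \<in> e" "w \<in> V" "w \<in> e"
    show "adj\<^sup>*\<^sup>* u w"
    proof (cases "y \<in> V")
      case True
      then have "adj\<^sup>*\<^sup>* u y"
        using IH e0 by blast
      moreover have "y = w \<or> adj y w"
        using True e unfolding adj_def by blast
      ultimately show ?thesis
        by (auto intro: rtranclp.rtrancl_into_rtrancl)
    next
      case False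
      then have "e = e0"
        using edges_meet_in_vertices[OF e(1) e0(1)] e(2) e0(3) by blast
      then show ?thesis
        using IH e by blast
    qed
  qed
qed

lemma walk_exists:
  assumes "u \<in> V" "w \<in> V"
  obtains f :: "nat \<Rightarrow> complex" and n where "f 0 = u" "f n = w" "\<And>i. i < n \<Longrightarrow> adj (f i) (f (Suc i))"
proof -
  have "graph_connected V E"
    using tree unfolding trivalent_planar_tree_def by (elim conjE)
  then have "(adjacent_vertices E)\<^sup>*\<^sup>* u w"
    using assms unfolding graph_connected_def by blast
  moreover obtain x where "adj w x"
    using another_neighbour[OF assms(2), of w w] by blast
  ultimately have "adj\<^sup>*\<^sup>* u w"
    using adjacent_imp_adj_path[of u w] assms edg_props(1,2)[of w x] by blast
  then obtain n where "(adj ^^ n) u w"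
    using rtranclp_imp_relpowp by metis
  then show ?thesis
    unfolding relpowp_fun_conv using that by blast
qed

text \<open>Regions are connected and contain vertices, so arbitrary points reduce to vertices, and
  these are joined by walks in the tree.\<close>

lemma sublevel_set_connected:
  assumes \<phi>: "markoff_map V E colR colE p q r s \<phi>"
    and k: "k \<ge> 2 + (cmod p + cmod q + cmod r + cmod s)"
  shows "connected (\<Union>(Omega_phi E \<phi> k))"
proof -
  define U where "U = \<Union>(Omega_phi E \<phi> k)"
  have to_vertex: "\<exists>v\<in>V. v \<in> U \<and> connected_component U x v" if x: "x \<in> U" for x
  proof -
    obtain R where R: "R \<in> regions E" "R \<subseteq> U" "x \<in> R"
      using x unfolding U_def Omega_phi_def by blast
    have "connected R"
      using connected_region[OF R(1)] .
    moreover obtain v where "v \<in> R" "v \<in> V"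
      using region_has_vertex[OF R(1)] .
    ultimately show ?thesis
      using R unfolding connected_component_def by blast
  qed
  have "connected_component U x y" if xy: "x \<in> U" "y \<in> U" for x y
  proof -
    obtain u w where uw: "u \<in> V" "u \<in> U" "connected_component U x u" "w \<in> V" "w \<in> U" "connected_component U y w"
      using to_vertex[OF xy(1)] to_vertex[OF xy(2)] by blast
    obtain f n where f: "f 0 = u" "f n = w" "\<And>i. i < n \<Longrightarrow> adj (f i) (f (Suc i))"
      using walk_exists[OF uw(1,4)] by metis
    then have "connected_component U u w"
      using walk_in_sublevel_set[OF \<phi> k, of n f] uw unfolding U_def by simp
    then show ?thesis
      using uw(3,6) by (metis connected_component_sym connected_component_trans)
  qed
  then show ?thesis
    unfolding U_def[symmetric] connected_iff_connected_component by blast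
qed

end

theorem theorem3p1:
  fixes V :: "complex set" and E :: "complex set set"
    and colR colE :: "complex set \<Rightarrow> nat" and p q r s :: complex
  assumes "trivalent_planar_tree V E"
    and "admissible_coloring V E colR colE"
  shows "(\<exists>l>0. \<forall>\<phi>. markoff_map V E colR colE p q r s \<phi> \<longrightarrow> Omega_phi E \<phi> l \<noteq> {}) \<and>
         (\<exists>\<alpha>\<ge>0. \<forall>\<phi>. markoff_map V E colR colE p q r s \<phi> \<longrightarrow>
             (\<forall>k. k \<ge> 2 + \<alpha> \<longrightarrow> connected (\<Union> (Omega_phi E \<phi> k))))"
proof -
  interpret coloured_tree V E colR colE
    using assms by unfold_locales
  let ?M = "cmod p + cmod q + cmod r + cmod s"
  show ?thesis
  proof (intro conjI exI[of _ "29 + ?M"] exI[of _ ?M] allI impI)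
    show "0 < 29 + ?M"
      using norm_ge_zero[of p] norm_ge_zero[of q] norm_ge_zero[of r] norm_ge_zero[of s] by linarith
  qed (auto intro: some_region_small[THEN notE] sublevel_set_connected)
qed

end
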